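(* Let $R$ be a locally compact topological ring. Then for every $k$-space $X$ its free semitopological $R$-module $M_R(X)$ (with its canonical map $i_X:X\to M_R(X)$) is a free topological $R$-module over $X$.
   Context: All topological spaces are Tychonoff. A topological ring is a unital ring (not necessarily commutative) with a Hausdorff topology making addition and multiplication jointly continuous. A semitopological (resp. topological) $R$-module is a unital left $R$-module $M$ endowed with a Hausdorff topology making $M$ an Abelian topological group and making the multiplication $R\times M\to M$ separately (resp. jointly) continuous. For a topological space $X$, a free semitopological $R$-module over $X$ is a pair $(M_R(X),i_X)$ consisting of a semitopological $R$-module $M_R(X)$ and a continuous map $i_X:X\to M_R(X)$ such that for any continuous map $f:X\to Y$ to a semitopological $R$-module $Y$ there exists a unique continuous $R$-linear map $\bar f:M_R(X)\to Y$ with $f=\bar f\circ i_X$. It exists and is unique up to isomorphism. A free topological $R$-module over $X$ is defined in the same way, with "semitopological" replaced by "topological" everywhere. A space $X$ is a $k$-space if a subset $A\subseteq X$ is closed in $X$ whenever $A\cap K$ is closed in $K$ for every compact $K\subseteq X$. *)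

theory Defs
  imports "HOL-Analysis.Analysis" "HOL-Algebra.Module"
begin

text \<open>
  Rings, modules and spaces are carrier-based (HOL-Algebra records and abstract topologies), since
  the universal properties below quantify over all modules with carrier in a given type. The locale
  \<open>module\<close> of HOL-Algebra requires a commutative ring, so left modules over arbitrary unital rings
  are introduced here. The fields \<open>mult\<close> and \<open>one\<close> of the module record are never used.
\<close>

locale left_module = R?: ring R + M?: abelian_group M
  for R (structure) and M :: "('r, 'm, 'c) module_scheme" (structure) +
  assumes smult_closed:
      "\<lbrakk>a \<in> carrier R; x \<in> carrier M\<rbrakk> \<Longrightarrow> a \<odot>\<^bsub>M\<^esub> x \<in> carrier M"
    and smult_l_distr:
      "\<lbrakk>a \<in> carrier R; b \<in> carrier R; x \<in> carrier M\<rbrakk> \<Longrightarrow>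
        (a \<oplus>\<^bsub>R\<^esub> b) \<odot>\<^bsub>M\<^esub> x = a \<odot>\<^bsub>M\<^esub> x \<oplus>\<^bsub>M\<^esub> b \<odot>\<^bsub>M\<^esub> x"
    and smult_r_distr:
      "\<lbrakk>a \<in> carrier R; x \<in> carrier M; y \<in> carrier M\<rbrakk> \<Longrightarrow>
        a \<odot>\<^bsub>M\<^esub> (x \<oplus>\<^bsub>M\<^esub> y) = a \<odot>\<^bsub>M\<^esub> x \<oplus>\<^bsub>M\<^esub> a \<odot>\<^bsub>M\<^esub> y"
    and smult_assoc1:
      "\<lbrakk>a \<in> carrier R; b \<in> carrier R; x \<in> carrier M\<rbrakk> \<Longrightarrow>
        (a \<otimes>\<^bsub>R\<^esub> b) \<odot>\<^bsub>M\<^esub> x = a \<odot>\<^bsub>M\<^esub> (b \<odot>\<^bsub>M\<^esub> x)"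
    and smult_one:
      "x \<in> carrier M \<Longrightarrow> \<one>\<^bsub>R\<^esub> \<odot>\<^bsub>M\<^esub> x = x"

definition linear_map ::
  "('r, 'a) ring_scheme \<Rightarrow> ('r, 'm, 'c) module_scheme \<Rightarrow> ('r, 'n, 'd) module_scheme \<Rightarrow> ('m \<Rightarrow> 'n) \<Rightarrow> bool"
where
  "linear_map R M N g \<longleftrightarrow>
     g \<in> carrier M \<rightarrow> carrier N \<and>
     (\<forall>x\<in>carrier M. \<forall>y\<in>carrier M. g (x \<oplus>\<^bsub>M\<^esub> y) = g x \<oplus>\<^bsub>N\<^esub> g y) \<and>
     (\<forall>a\<in>carrier R. \<forall>x\<in>carrier M. g (a \<odot>\<^bsub>M\<^esub> x) = a \<odot>\<^bsub>N\<^esub> g x)"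

definition tychonoff_space :: "'x topology \<Rightarrow> bool" where
  "tychonoff_space X \<longleftrightarrow> completely_regular_space X \<and> Hausdorff_space X"

text \<open>
  Continuity of negation in a topological ring need not be assumed: \<open>-x = (-1)x\<close>.
  The Hausdorff topologies below are Tychonoff because the additive groups are topological groups.
\<close>

definition topological_ring :: "('r, 'a) ring_scheme \<Rightarrow> 'r topology \<Rightarrow> bool" where
  "topological_ring R TR \<longleftrightarrow>
     ring R \<and> topspace TR = carrier R \<and> Hausdorff_space TR \<and>
     continuous_map (prod_topology TR TR) TR (\<lambda>(x, y). x \<oplus>\<^bsub>R\<^esub> y) \<and>
     continuous_map (prod_topology TR TR) TR (\<lambda>(x, y). x \<otimes>\<^bsub>R\<^esub> y)"

definition topological_abelian_group :: "('m, 'b) ring_scheme \<Rightarrow> 'm topology \<Rightarrow> bool" where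
  "topological_abelian_group M TM \<longleftrightarrow>
     abelian_group M \<and> topspace TM = carrier M \<and>
     continuous_map (prod_topology TM TM) TM (\<lambda>(x, y). x \<oplus>\<^bsub>M\<^esub> y) \<and>
     continuous_map TM TM (\<lambda>x. \<ominus>\<^bsub>M\<^esub> x)"

definition semitopological_module ::
  "('r, 'a) ring_scheme \<Rightarrow> 'r topology \<Rightarrow> ('r, 'm, 'c) module_scheme \<Rightarrow> 'm topology \<Rightarrow> bool"
where
  "semitopological_module R TR M TM \<longleftrightarrow>
     left_module R M \<and> topological_abelian_group M TM \<and> Hausdorff_space TM \<and>
     (\<forall>a\<in>carrier R. continuous_map TM TM (\<lambda>x. a \<odot>\<^bsub>M\<^esub> x)) \<and>
     (\<forall>x\<in>carrier M. continuous_map TR TM (\<lambda>a. a \<odot>\<^bsub>M\<^esub> x))"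

definition topological_module ::
  "('r, 'a) ring_scheme \<Rightarrow> 'r topology \<Rightarrow> ('r, 'm, 'c) module_scheme \<Rightarrow> 'm topology \<Rightarrow> bool"
where
  "topological_module R TR M TM \<longleftrightarrow>
     left_module R M \<and> topological_abelian_group M TM \<and> Hausdorff_space TM \<and>
     continuous_map (prod_topology TR TM) TM (\<lambda>(a, x). a \<odot>\<^bsub>M\<^esub> x)"

text \<open>
  Maps out of \<open>M\<close> are identified when they agree on \<open>carrier M\<close>, hence the
  \<open>extensional\<close> in the uniqueness statement.
\<close>

definition extends_uniquely ::
  "('r, 'a) ring_scheme \<Rightarrow> 'x topology \<Rightarrow> ('r, 'm, 'c) module_scheme \<Rightarrow> 'm topology \<Rightarrow> ('x \<Rightarrow> 'm) \<Rightarrow>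
   ('r, 'n, 'd) module_scheme \<Rightarrow> 'n topology \<Rightarrow> ('x \<Rightarrow> 'n) \<Rightarrow> bool"
where
  "extends_uniquely R X M TM i Y TY f \<longleftrightarrow>
     (\<exists>!g. g \<in> extensional (carrier M) \<and> linear_map R M Y g \<and> continuous_map TM TY g \<and>
           (\<forall>x\<in>topspace X. f x = g (i x)))"

text \<open>
  A formula of HOL cannot quantify over types, so freeness is relative to a type \<open>'u\<close>: the universal
  property is required for all modules \<open>Y\<close> whose carrier is a subset of \<open>'u\<close>. Freeness in the absolute
  sense is freeness relative to every type. A conclusion stated for an arbitrary type variable
  therefore expresses absolute freeness. A hypothesis of freeness relative to one particular type is
  implied by absolute freeness. For the semitopological case the type \<open>'m + ('x \<Rightarrow> 'r)\<close> is large enough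
  for the converse: it can host the submodules of \<open>M\<close> (so \<open>M\<close> is generated by the image of \<open>i\<close>, which
  gives uniqueness of extensions), and also a copy of the submodule of an arbitrary \<open>Y\<close> generated by
  the image of \<open>X\<close>, which is a quotient of the finitely supported functions from \<open>X\<close> to \<open>R\<close>.
\<close>

definition free_semitopological_module ::
  "'u itself \<Rightarrow> ('r, 'a) ring_scheme \<Rightarrow> 'r topology \<Rightarrow> 'x topology \<Rightarrow>
   ('r, 'm, 'c) module_scheme \<Rightarrow> 'm topology \<Rightarrow> ('x \<Rightarrow> 'm) \<Rightarrow> bool"
where
  "free_semitopological_module U R TR X M TM i \<longleftrightarrow>
     semitopological_module R TR M TM \<and> continuous_map X TM i \<and>
     (\<forall>(Y :: ('r, 'u) module) TY f.
        semitopological_module R TR Y TY \<and> continuous_map X TY f \<longrightarrow>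
        extends_uniquely R X M TM i Y TY f)"

definition free_topological_module ::
  "'u itself \<Rightarrow> ('r, 'a) ring_scheme \<Rightarrow> 'r topology \<Rightarrow> 'x topology \<Rightarrow>
   ('r, 'm, 'c) module_scheme \<Rightarrow> 'm topology \<Rightarrow> ('x \<Rightarrow> 'm) \<Rightarrow> bool"
where
  "free_topological_module U R TR X M TM i \<longleftrightarrow>
     topological_module R TR M TM \<and> continuous_map X TM i \<and>
     (\<forall>(Y :: ('r, 'u) module) TY f.
        topological_module R TR Y TY \<and> continuous_map X TY f \<longrightarrow>
        extends_uniquely R X M TM i Y TY f)"

end

theory Submission
  imports Defs
begin

text \<open>
  Only the joint continuity of scalar multiplication on \<open>M\<close> is at stake: topological modules are
  semitopological, so once \<open>M\<close> is a topological module, its universal property among topological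
  modules is inherited from the one among semitopological modules.
  
  The scalar multiplication is first shown to be jointly continuous on generators, that is, the map
  \<open>(a, x) \<mapsto> a \<odot> i x\<close> is jointly continuous on \<open>R \<times> X\<close>. A priori it is only separately continuous, but it
  is additive in \<open>a\<close>. A Namioka-type theorem (\<open>separately_continuous_small_oscillation\<close>) says that a
  separately continuous map from (locally compact) \<open>\<times>\<close> (compact \<open>K\<close>) into a topological group has,
  near some point of the first factor, small oscillation in that factor, uniformly in \<open>K\<close>. Additivity
  translates that point to any other one, so the map is jointly continuous on \<open>R \<times> K\<close> for every
  compact \<open>K \<subseteq> X\<close>. As \<open>R\<close> is locally compact and \<open>X\<close> is a k-space, \<open>R \<times> X\<close> is a k-space too, and
  joint continuity on all \<open>R \<times> K\<close> gives joint continuity on \<open>R \<times> X\<close>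
  (\<open>continuous_map_smult_k_space\<close>).
  
  The passage from generators to all of \<open>M\<close> is by the exponential law. Map \<open>m\<close> to the function
  \<open>a \<mapsto> a \<odot> m\<close> from \<open>R\<close> to \<open>M\<close>, and let \<open>T\<close> be the topology that the compact-open topology induces on
  \<open>M\<close> through this map. For locally compact \<open>R\<close> a map \<open>h\<close> into \<open>(M, T)\<close> is continuous if and only if
  \<open>(a, z) \<mapsto> a \<odot> h z\<close> is continuous into the original \<open>M\<close>. By this criterion \<open>(M, T)\<close> is again a
  semitopological module, \<open>T\<close> is finer than the given topology, and \<open>i\<close> is continuous into \<open>(M, T)\<close>,
  by the joint continuity on \<open>R \<times> X\<close>. The universal property of \<open>M\<close> now makes the identity
  \<open>M \<rightarrow> (M, T)\<close> continuous, so both topologies agree, and evaluation \<open>R \<times> (M, T) \<rightarrow> M\<close> being jointly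
  continuous says that \<open>M\<close> is a topological module.
  
  The universal property is given only for modules carried by one type, whereas the conclusion speaks
  of modules carried by an arbitrary type. The difference is bridged by replacing a target \<open>Y\<close> by
  the submodule generated by the image of \<open>X\<close>, which is a quotient of the finitely supported functions
  from \<open>X\<close> to \<open>R\<close>, and carrying that submodule over to the type at hand.
\<close>

section \<open>Topological abelian groups\<close>

lemma topological_abelian_groupD:
  assumes "topological_abelian_group G TG"
  shows "abelian_group G" "topspace TG = carrier G"
  using assms by (auto simp: topological_abelian_group_def)

lemma (in abelian_group) diff_self: "x \<in> carrier G \<Longrightarrow> x \<ominus> x = \<zero>"
  by (simp add: a_minus_def r_neg)

lemma (in abelian_group) diff_add_diff_cancel:
  "\<lbrakk>x \<in> carrier G; y \<in> carrier G; z \<in> carrier G\<rbrakk> \<Longrightarrow> (x \<ominus> y) \<oplus> (y \<ominus> z) = x \<ominus> z"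
  by (simp add: a_minus_def a_assoc r_neg1)

lemma (in abelian_group) diff_diff_cancel:
  assumes "x \<in> carrier G" "y \<in> carrier G" "z \<in> carrier G"
  shows "(x \<ominus> z) \<ominus> (y \<ominus> z) = x \<ominus> y"
proof -
  have "\<ominus> (y \<ominus> z) = z \<ominus> y"
    using assms by (simp add: a_minus_def minus_add a_comm)
  then have "(x \<ominus> z) \<ominus> (y \<ominus> z) = (x \<ominus> z) \<oplus> (z \<ominus> y)"
    by (simp add: a_minus_def[of G "x \<ominus> z"])
  then show ?thesis using assms diff_add_diff_cancel by simp
qed

lemma continuous_map_group_add:
  assumes "topological_abelian_group G TG" "continuous_map Z TG f" "continuous_map Z TG g"
  shows "continuous_map Z TG (\<lambda>z. f z \<oplus>\<^bsub>G\<^esub> g z)"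
proof -
  have "continuous_map Z TG ((\<lambda>(x, y). x \<oplus>\<^bsub>G\<^esub> y) \<circ> (\<lambda>z. (f z, g z)))"
    using assms by (intro continuous_map_compose[of _ "prod_topology TG TG"])
      (auto simp: topological_abelian_group_def continuous_map_paired)
  then show ?thesis by (simp add: o_def)
qed

lemma continuous_map_group_diff:
  assumes "topological_abelian_group G TG" "continuous_map Z TG f" "continuous_map Z TG g"
  shows "continuous_map Z TG (\<lambda>z. f z \<ominus>\<^bsub>G\<^esub> g z)"
proof -
  have "continuous_map Z TG ((\<lambda>y. \<ominus>\<^bsub>G\<^esub> y) \<circ> g)"
    using assms by (intro continuous_map_compose[of _ TG])
      (auto simp: topological_abelian_group_def)
  then show ?thesis
    using continuous_map_group_add[OF assms(1,2)] by (simp add: o_def a_minus_def)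
qed

text \<open>
  Topological groups are regular at zero: if \<open>U - U \<subseteq> V\<close>, then the closure of \<open>U\<close> lies in \<open>V\<close>,
  because a point \<open>z\<close> of the closure has some \<open>w \<in> U\<close> with \<open>w - z \<in> U\<close>, and \<open>z = w - (w - z)\<close>.
\<close>

lemma topological_group_closed_neighbourhood:
  assumes G: "topological_abelian_group G TG" and V: "openin TG V" "\<zero>\<^bsub>G\<^esub> \<in> V"
  obtains U C where "openin TG U" "closedin TG C" "\<zero>\<^bsub>G\<^esub> \<in> U" "U \<subseteq> C" "C \<subseteq> V"
proof -
  interpret abelian_group G using topological_abelian_groupD[OF G] by simp
  have ts: "topspace TG = carrier G" using topological_abelian_groupD[OF G] by simp
  have "continuous_map (prod_topology TG TG) TG (\<lambda>p. fst p \<ominus>\<^bsub>G\<^esub> snd p)"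
    by (intro continuous_map_group_diff[OF G] continuous_map_fst continuous_map_snd)
  then have "openin (prod_topology TG TG)
      {p \<in> topspace (prod_topology TG TG). fst p \<ominus>\<^bsub>G\<^esub> snd p \<in> V}" (is "openin _ ?S")
    using V openin_continuous_map_preimage by blast
  moreover have "(\<zero>\<^bsub>G\<^esub>, \<zero>\<^bsub>G\<^esub>) \<in> ?S"
    using V ts by (simp add: diff_self)
  ultimately obtain P Q where PQ: "openin TG P" "openin TG Q" "\<zero>\<^bsub>G\<^esub> \<in> P" "\<zero>\<^bsub>G\<^esub> \<in> Q" "P \<times> Q \<subseteq> ?S"
    unfolding openin_prod_topology_alt by meson
  define U where "U = P \<inter> Q"
  have U: "openin TG U" "\<zero>\<^bsub>G\<^esub> \<in> U" using PQ by (auto simp: U_def)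
  have UV: "x \<ominus>\<^bsub>G\<^esub> y \<in> V" if "x \<in> U" "y \<in> U" for x y
    using that PQ by (auto simp: U_def)
  have "TG closure_of U \<subseteq> V"
  proof
    fix z assume z: "z \<in> TG closure_of U"
    then have zG: "z \<in> carrier G" by (simp add: in_closure_of ts)
    have "continuous_map TG TG (\<lambda>w. w \<ominus>\<^bsub>G\<^esub> z)"
      using zG ts by (intro continuous_map_group_diff[OF G]) auto
    then have "openin TG {w \<in> topspace TG. w \<ominus>\<^bsub>G\<^esub> z \<in> U}"
      using U openin_continuous_map_preimage by blast
    moreover have "z \<in> {w \<in> topspace TG. w \<ominus>\<^bsub>G\<^esub> z \<in> U}"
      using zG ts U by (simp add: diff_self)
    ultimately have "\<exists>w\<in>U. w \<in> {w \<in> topspace TG. w \<ominus>\<^bsub>G\<^esub> z \<in> U}"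
      using z unfolding in_closure_of by meson
    then obtain w where w: "w \<in> U" "w \<ominus>\<^bsub>G\<^esub> z \<in> U" "w \<in> carrier G"
      using ts by auto
    have "w \<ominus>\<^bsub>G\<^esub> (w \<ominus>\<^bsub>G\<^esub> z) = z"
      using w(3) zG by (simp add: a_minus_def minus_add r_neg2)
    then show "z \<in> V" using UV[OF w(1,2)] by simp
  qed
  then show ?thesis
    using that[of U "TG closure_of U"] U by (simp add: closure_of_subset openin_subset)
qed

section \<open>Separate and joint continuity\<close>

lemma compactin_decreasing_closed_nonempty:
  fixes C :: "nat \<Rightarrow> 'a set"
  assumes "compactin X (C 0)" "\<And>n. closedin X (C n)" "\<And>n. C n \<noteq> {}" "\<And>n. C (Suc n) \<subseteq> C n"
  shows "\<exists>a. \<forall>n. a \<in> C n"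
proof -
  have mono: "C n \<subseteq> C m" if "m \<le> n" for m n
    using assms(4) by (rule lift_Suc_antimono_le[OF _ that])
  have "C 0 \<inter> \<Inter>(range C) \<noteq> {}"
  proof -
    have "C 0 \<inter> \<Inter>F \<noteq> {}" if F: "finite F" "F \<subseteq> range C" for F
    proof -
      obtain I where I: "finite I" "F = C ` I" using F finite_subset_image by metis
      have "C (Max (insert 0 I)) \<subseteq> C i" if "i \<in> insert 0 I" for i
        using I(1) that by (intro mono Max_ge) auto
      then have "C (Max (insert 0 I)) \<subseteq> C 0 \<inter> \<Inter>F" unfolding I(2) by blast
      then show ?thesis using assms(3) by blast
    qed
    then show ?thesis
      using assms(1,2) unfolding compactin_fip by blast
  qed
  then show ?thesis by blast
qed

text \<open>
  A Namioka-type theorem, proved by Christensen's topological game. If it failed below \<open>U\<close>, one could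
  choose recursively a decreasing sequence of closed compact sets \<open>N n\<close> with nonempty interior, points,
  one from each \<open>N (Suc n)\<close>, collected in the finite sets \<open>F n\<close>, and pairs \<open>x n\<close>, \<open>y n\<close> in the compact factor such that
  \<open>\<phi> f (x n) - \<phi> f (y n)\<close> is very small for the points \<open>f\<close> chosen so far, while
  \<open>\<phi> b (x n) - \<phi> b (y n)\<close> is not small for any \<open>b\<close> in the next compact set. Let \<open>(x', y')\<close> be a cluster
  point of the pairs. Then \<open>\<phi> b x' - \<phi> b y'\<close> is very small for all chosen points \<open>b\<close>, hence for some
  point in the intersection of all \<open>N n\<close>; but in this intersection it is never small.
\<close>

lemma separately_continuous_small_oscillation:
  assumes A: "locally_compact_space TA" "regular_space TA"
    and K: "compact_space TK" and G: "topological_abelian_group G TG"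
    and contA: "\<And>x. x \<in> topspace TK \<Longrightarrow> continuous_map TA TG (\<lambda>a. \<phi> a x)"
    and contK: "\<And>a. a \<in> topspace TA \<Longrightarrow> continuous_map TK TG (\<lambda>x. \<phi> a x)"
    and U: "openin TA U" "U \<noteq> {}" and V: "openin TG V" "\<zero>\<^bsub>G\<^esub> \<in> V"
  shows "\<exists>b\<in>U. \<exists>U'. openin TA U' \<and> b \<in> U' \<and> U' \<subseteq> U \<and>
           (\<forall>a\<in>U'. \<forall>x\<in>topspace TK. \<phi> a x \<ominus>\<^bsub>G\<^esub> \<phi> b x \<in> V)"
proof (rule ccontr)
  assume contr: "\<not> ?thesis"
  interpret abelian_group G using topological_abelian_groupD[OF G] by simp
  have ts: "topspace TG = carrier G" using topological_abelian_groupD[OF G] by simp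
  have \<phi>G: "\<phi> a x \<in> carrier G" if "a \<in> topspace TA" "x \<in> topspace TK" for a x
    using continuous_map_funspace[OF contK[OF that(1)]] that ts by auto
  define d where "d a x y = \<phi> a x \<ominus>\<^bsub>G\<^esub> \<phi> a y" for a x y
  obtain W where W: "openin TG W" "\<zero>\<^bsub>G\<^esub> \<in> W"
    and WV: "\<And>p q r. \<lbrakk>p \<in> W; q \<in> W; r \<in> W\<rbrakk> \<Longrightarrow> (p \<oplus>\<^bsub>G\<^esub> q) \<ominus>\<^bsub>G\<^esub> r \<in> V"
  proof -
    let ?T = "prod_topology TG (prod_topology TG TG)"
    have "continuous_map ?T TG (\<lambda>p. (fst p \<oplus>\<^bsub>G\<^esub> (fst \<circ> snd) p) \<ominus>\<^bsub>G\<^esub> (snd \<circ> snd) p)"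
      by (intro continuous_map_group_diff[OF G] continuous_map_group_add[OF G] continuous_map_fst
          continuous_map_compose[OF continuous_map_snd continuous_map_fst]
          continuous_map_compose[OF continuous_map_snd continuous_map_snd])
    then have "openin ?T {p \<in> topspace ?T. (fst p \<oplus>\<^bsub>G\<^esub> (fst \<circ> snd) p) \<ominus>\<^bsub>G\<^esub> (snd \<circ> snd) p \<in> V}"
        (is "openin _ ?S")
      using V openin_continuous_map_preimage by blast
    moreover have "(\<zero>\<^bsub>G\<^esub>, \<zero>\<^bsub>G\<^esub>, \<zero>\<^bsub>G\<^esub>) \<in> ?S"
      using V ts by (simp add: diff_self)
    ultimately obtain P Q' where P: "openin TG P" "\<zero>\<^bsub>G\<^esub> \<in> P" "openin (prod_topology TG TG) Q'"
        "(\<zero>\<^bsub>G\<^esub>, \<zero>\<^bsub>G\<^esub>) \<in> Q'" "P \<times> Q' \<subseteq> ?S"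
      unfolding openin_prod_topology_alt[of TG] by meson
    from P(3,4) obtain Q Q2 where Q: "openin TG Q" "openin TG Q2" "\<zero>\<^bsub>G\<^esub> \<in> Q" "\<zero>\<^bsub>G\<^esub> \<in> Q2" "Q \<times> Q2 \<subseteq> Q'"
      unfolding openin_prod_topology_alt by meson
    show ?thesis
    proof (rule that[of "P \<inter> (Q \<inter> Q2)"])
      fix p q r assume "p \<in> P \<inter> (Q \<inter> Q2)" "q \<in> P \<inter> (Q \<inter> Q2)" "r \<in> P \<inter> (Q \<inter> Q2)"
      then have "(p, q, r) \<in> ?S" using P(5) Q(5) by blast
      then show "(p \<oplus>\<^bsub>G\<^esub> q) \<ominus>\<^bsub>G\<^esub> r \<in> V" by simp
    qed (use P Q in auto)
  qed
  \<comment> \<open>\<open>W\<close>, \<open>C1\<close> and \<open>O1\<close> express that a difference is small, \<open>C0\<close> and \<open>O0\<close> that it is very small.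
      Closed sets in between make both properties survive the passage to cluster points.\<close>
  obtain O1 C1 where C1: "openin TG O1" "closedin TG C1" "\<zero>\<^bsub>G\<^esub> \<in> O1" "O1 \<subseteq> C1" "C1 \<subseteq> W"
    using topological_group_closed_neighbourhood[OF G W] .
  obtain O0 C0 where C0: "openin TG O0" "closedin TG C0" "\<zero>\<^bsub>G\<^esub> \<in> O0" "O0 \<subseteq> C0" "C0 \<subseteq> O1"
    using topological_group_closed_neighbourhood[OF G C1(1,3)] .
  \<comment> \<open>One move of the game. If no such pair existed, finitely many points \<open>y\<close> would represent all of the
      compact factor up to differences that are small throughout \<open>U'\<close>, and continuity in the first
      variable at these finitely many \<open>y\<close> would bound the oscillation for all \<open>x\<close> at once.\<close>
  have step: "\<exists>x\<in>topspace TK. \<exists>y\<in>topspace TK. \<exists>b\<in>U'. (\<forall>f\<in>F. d f x y \<in> O0) \<and> d b x y \<notin> C1"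
    if F: "finite F" "F \<subseteq> topspace TA" and U': "openin TA U'" "U' \<noteq> {}" "U' \<subseteq> U" for F U'
  proof (rule ccontr)
    assume neg: "\<not> ?thesis"
    obtain b where b: "b \<in> U'" using U' by blast
    have U'A: "U' \<subseteq> topspace TA" using U' openin_subset by blast
    have bG: "\<phi> b y \<in> carrier G" if "y \<in> topspace TK" for y
      using \<phi>G b U'A that by blast
    define E where "E y = {x \<in> topspace TK. \<forall>f\<in>F. d f x y \<in> O0}" for y
    have openE: "openin TK (E y)" if y: "y \<in> topspace TK" for y
    proof -
      have *: "openin TK {x \<in> topspace TK. d f x y \<in> O0}" if "f \<in> F" for f
      proof -
        have "continuous_map TK TG (\<lambda>x. d f x y)"
          unfolding d_def using that F y \<phi>G ts
          by (intro continuous_map_group_diff[OF G] contK) auto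
        then show ?thesis using C0 openin_continuous_map_preimage by blast
      qed
      have "E y = topspace TK \<inter> (\<Inter>f\<in>F. {x \<in> topspace TK. d f x y \<in> O0})"
        by (auto simp: E_def)
      then show ?thesis using * F(1)
        by (cases "F = {}") (auto intro!: openin_Int openin_INT2)
    qed
    have selfE: "y \<in> E y" if "y \<in> topspace TK" for y
      using that F C0 \<phi>G by (auto simp: E_def d_def diff_self)
    have "\<forall>O'\<in>E ` topspace TK. openin TK O'" "topspace TK \<subseteq> \<Union>(E ` topspace TK)"
      using openE selfE by auto
    then have "\<exists>\<F>. finite \<F> \<and> \<F> \<subseteq> E ` topspace TK \<and> topspace TK \<subseteq> \<Union>\<F>"
      using K unfolding compact_space_alt by (elim allE[of _ "E ` topspace TK"]) blast
    then obtain Y where Y: "finite Y" "Y \<subseteq> topspace TK" "topspace TK \<subseteq> (\<Union>y\<in>Y. E y)"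
      using finite_subset_image by metis
    define U'' where "U'' = U' \<inter> (\<Inter>y\<in>Y. {a \<in> topspace TA. \<phi> a y \<ominus>\<^bsub>G\<^esub> \<phi> b y \<in> W})"
    have "openin TA {a \<in> topspace TA. \<phi> a y \<ominus>\<^bsub>G\<^esub> \<phi> b y \<in> W}" if "y \<in> Y" for y
    proof -
      have "continuous_map TA TG (\<lambda>a. \<phi> a y \<ominus>\<^bsub>G\<^esub> \<phi> b y)"
        using that Y(2) bG ts
        by (intro continuous_map_group_diff[OF G] contA) (auto simp: subset_iff)
      then show ?thesis using W openin_continuous_map_preimage by blast
    qed
    then have "openin TA U''"
      using U' Y(1) by (cases "Y = {}") (auto simp: U''_def intro!: openin_Int openin_INT2)
    moreover have "b \<in> U''"
      using b U'A Y(2) W bG by (auto simp: U''_def diff_self subset_iff)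
    moreover have "U'' \<subseteq> U" using U' by (auto simp: U''_def)
    moreover have "\<phi> a x \<ominus>\<^bsub>G\<^esub> \<phi> b x \<in> V" if a: "a \<in> U''" and x: "x \<in> topspace TK" for a x
    proof -
      obtain y where y: "y \<in> Y" "x \<in> E y" using Y x by blast
      have yK: "y \<in> topspace TK" using y Y by blast
      have aU: "a \<in> U'" using a by (simp add: U''_def)
      have "d c x y \<in> C1" if "c \<in> U'" for c
        using neg that x yK y(2) unfolding E_def by blast
      then have dW: "d c x y \<in> W" if "c \<in> U'" for c
        using that C1(5) by blast
      have "\<phi> a y \<ominus>\<^bsub>G\<^esub> \<phi> b y \<in> W" using a y by (auto simp: U''_def)
      then have "(d a x y \<oplus>\<^bsub>G\<^esub> (\<phi> a y \<ominus>\<^bsub>G\<^esub> \<phi> b y)) \<ominus>\<^bsub>G\<^esub> d b x y \<in> V"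
        using WV dW aU b by blast
      moreover have "(d a x y \<oplus>\<^bsub>G\<^esub> (\<phi> a y \<ominus>\<^bsub>G\<^esub> \<phi> b y)) \<ominus>\<^bsub>G\<^esub> d b x y = \<phi> a x \<ominus>\<^bsub>G\<^esub> \<phi> b x"
      proof -
        have c: "\<phi> a x \<in> carrier G" "\<phi> a y \<in> carrier G" "\<phi> b x \<in> carrier G" "\<phi> b y \<in> carrier G"
          using \<phi>G aU b U'A x yK by auto
        then show ?thesis unfolding d_def
          by (simp add: diff_add_diff_cancel diff_diff_cancel)
      qed
      ultimately show ?thesis by simp
    qed
    ultimately show False using contr b U' by blast
  qed
  \<comment> \<open>A state of the game is \<open>(N, F, x, y)\<close>; \<open>P\<close> holds for the legal states and \<open>Q\<close> for the legal moves.\<close>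
  define P where "P s = (case s of (N, F, x, y) \<Rightarrow>
      compactin TA N \<and> closedin TA N \<and> N \<subseteq> U \<and> (\<exists>O'. openin TA O' \<and> O' \<noteq> {} \<and> O' \<subseteq> N) \<and>
      finite F \<and> F \<subseteq> topspace TA)"
    for s :: "'a set \<times> 'a set \<times> 'b \<times> 'b"
  define Q where "Q s s' = (case (s, s') of ((N, F, x, y), (N', F', x', y')) \<Rightarrow>
      N' \<subseteq> N \<and> F \<subseteq> F' \<and> F' \<inter> N' \<noteq> {} \<and> x' \<in> topspace TK \<and> y' \<in> topspace TK \<and>
      (\<forall>f\<in>F. d f x' y' \<in> O0) \<and> (\<forall>b\<in>N'. d b x' y' \<notin> C1))"
    for s s' :: "'a set \<times> 'a set \<times> 'b \<times> 'b"
  have nbd: "\<exists>O' N. openin TA O' \<and> compactin TA N \<and> closedin TA N \<and> a \<in> O' \<and> O' \<subseteq> N \<and> N \<subseteq> T"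
    if "openin TA T" "a \<in> T" for T a
  proof -
    have "neighbourhood_base_of (\<lambda>C. compactin TA C \<and> closedin TA C) TA"
      using A by (simp add: locally_compact_space_neighbourhood_base_closedin)
    then show ?thesis
      using that unfolding neighbourhood_base_of by meson
  qed
  have P0: "\<exists>s. P s"
  proof -
    obtain a where "a \<in> U" using U by blast
    then obtain O' N where "openin TA O'" "compactin TA N" "closedin TA N" "a \<in> O'" "O' \<subseteq> N" "N \<subseteq> U"
      using nbd U by meson
    then have "P (N, {}, undefined, undefined)" unfolding P_def by auto
    then show ?thesis ..
  qed
  have PQ: "\<exists>s'. P s' \<and> Q s s'" if Ps: "P s" for s
  proof -
    obtain N F x0 y0 where s: "s = (N, F, x0, y0)" by (metis prod_cases4)
    obtain O' where O': "openin TA O'" "O' \<noteq> {}" "O' \<subseteq> N" and N: "N \<subseteq> U" "finite F" "F \<subseteq> topspace TA"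
      using Ps unfolding P_def s by auto
    obtain x y b where xy: "x \<in> topspace TK" "y \<in> topspace TK" "b \<in> O'"
        "\<forall>f\<in>F. d f x y \<in> O0" "d b x y \<notin> C1"
      using step[OF N(2,3) O'(1,2)] O' N by blast
    have "continuous_map TA TG (\<lambda>b. d b x y)"
      unfolding d_def using xy by (intro continuous_map_group_diff[OF G] contA) auto
    then have "openin TA {b \<in> topspace TA. d b x y \<in> topspace TG - C1}"
      using C1(2) openin_continuous_map_preimage by blast
    then have "openin TA (O' \<inter> {b \<in> topspace TA. d b x y \<in> topspace TG - C1})" (is "openin TA ?T")
      using O' by blast
    moreover have "b \<in> ?T"
      using xy openin_subset[OF O'(1)] \<phi>G ts by (auto simp: d_def)
    ultimately obtain O2 N2 where O2: "openin TA O2" "compactin TA N2" "closedin TA N2"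
        "b \<in> O2" "O2 \<subseteq> N2" "N2 \<subseteq> ?T"
      using nbd by meson
    have "P (N2, insert b F, x, y)"
      unfolding P_def using O2 O' N xy openin_subset[OF O'(1)] by auto
    moreover have "Q s (N2, insert b F, x, y)"
      unfolding Q_def s using O2 O' N xy by auto
    ultimately show ?thesis by blast
  qed
  have "\<exists>f. \<forall>n::nat. P (f n) \<and> Q (f n) (f (Suc n))"
    by (rule dependent_nat_choice) (use P0 PQ in auto)
  then obtain s where s: "\<And>n::nat. P (s n)" "\<And>n. Q (s n) (s (Suc n))" by blast
  \<comment> \<open>The pair found in move \<open>n\<close> is stored in state \<open>Suc n\<close>.\<close>
  define N F x y where "N n = fst (s n)" and "F n = fst (snd (s n))"
    and "x n = fst (snd (snd (s (Suc n))))" and "y n = snd (snd (snd (s (Suc n))))" for n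
  have N: "compactin TA (N n)" "closedin TA (N n)" "N (Suc n) \<subseteq> N n" for n
    using s[of n] by (auto simp: P_def Q_def N_def split: prod.splits)
  have F: "F n \<subseteq> topspace TA" "F n \<subseteq> F (Suc n)" "F (Suc n) \<inter> N (Suc n) \<noteq> {}" for n
    using s[of n] by (auto simp: P_def Q_def N_def F_def split: prod.splits)
  have xyK: "x n \<in> topspace TK" "y n \<in> topspace TK" for n
    using s(2)[of n] by (auto simp: Q_def x_def y_def split: prod.splits)
  have dF: "d f (x n) (y n) \<in> O0" if "f \<in> F n" for f n
    using s(2)[of n] that by (auto simp: Q_def F_def x_def y_def split: prod.splits)
  have dN: "d b (x n) (y n) \<notin> C1" if "b \<in> N (Suc n)" for b n
    using s(2)[of n] that by (auto simp: Q_def N_def x_def y_def split: prod.splits)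
  have Fmono: "F m \<subseteq> F n" if "m \<le> n" for m n
    using F(2) by (rule lift_Suc_mono_le[OF _ that])
  let ?KK = "prod_topology TK TK"
  define Z where "Z n = ?KK closure_of {(x m, y m) | m. m \<ge> n}" for n
  have "compactin ?KK (Z 0)"
    using K by (intro closedin_compact_space)
      (auto simp: Z_def compact_space_prod_topology)
  moreover have "closedin ?KK (Z n)" for n by (simp add: Z_def)
  moreover have "Z n \<noteq> {}" for n
  proof -
    have "{(x m, y m) | m. m \<ge> n} \<subseteq> topspace ?KK" using xyK by auto
    then have "{(x m, y m) | m. m \<ge> n} \<subseteq> Z n" unfolding Z_def by (rule closure_of_subset)
    then show ?thesis by blast
  qed
  moreover have "Z (Suc n) \<subseteq> Z n" for n
    unfolding Z_def by (intro closure_of_mono) auto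
  ultimately have "\<exists>p. \<forall>n. p \<in> Z n"
    by (rule compactin_decreasing_closed_nonempty)
  then obtain p where p: "\<And>n. p \<in> Z n" by blast
  obtain x' y' where p_eq: "p = (x', y')" by fastforce
  have xy': "x' \<in> topspace TK" "y' \<in> topspace TK"
    using p[of 0] closure_of_subset_topspace[of ?KK] unfolding Z_def p_eq by fastforce+
  have limit: "d a x' y' \<in> C"
    if C: "closedin TG C" and a: "a \<in> topspace TA" and inC: "\<And>m. m \<ge> n \<Longrightarrow> d a (x m) (y m) \<in> C"
    for C a n
  proof -
    have "continuous_map ?KK TG (\<lambda>q. (\<phi> a \<circ> fst) q \<ominus>\<^bsub>G\<^esub> (\<phi> a \<circ> snd) q)"
      using a by (intro continuous_map_group_diff[OF G]
        continuous_map_compose[OF continuous_map_fst] continuous_map_compose[OF continuous_map_snd] contK)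
    then have "closedin ?KK {q \<in> topspace ?KK. (\<phi> a \<circ> fst) q \<ominus>\<^bsub>G\<^esub> (\<phi> a \<circ> snd) q \<in> C}"
        (is "closedin _ ?S")
      using C closedin_continuous_map_preimage by blast
    moreover have "{(x m, y m) | m. m \<ge> n} \<subseteq> ?S"
      using xyK inC by (auto simp: d_def)
    ultimately have "Z n \<subseteq> ?S" unfolding Z_def by (rule closure_of_minimal[rotated])
    then show ?thesis using p[of n] by (auto simp: p_eq d_def)
  qed
  define B where "B = {a \<in> topspace TA. d a x' y' \<in> C0}"
  have "continuous_map TA TG (\<lambda>b. d b x' y')"
    unfolding d_def using xy' by (intro continuous_map_group_diff[OF G] contA) auto
  then have Bcl: "closedin TA B"
    unfolding B_def using C0(2) closedin_continuous_map_preimage by blast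
  have FB: "F n \<subseteq> B" for n
  proof
    fix a assume a: "a \<in> F n"
    have "d a (x m) (y m) \<in> C0" if "m \<ge> n" for m
      using dF[of a m] Fmono[OF that] a C0(4) by blast
    moreover have "a \<in> topspace TA" using a F(1) by blast
    ultimately show "a \<in> B"
      unfolding B_def using limit[OF C0(2), of a n] by blast
  qed
  have "\<exists>a. \<forall>n. a \<in> N (Suc n) \<inter> B"
  proof (rule compactin_decreasing_closed_nonempty[of TA "\<lambda>n. N (Suc n) \<inter> B"])
    show "compactin TA (N (Suc 0) \<inter> B)" using N(1) Bcl by (rule compact_Int_closedin)
    show "closedin TA (N (Suc n) \<inter> B)" for n using N(2) Bcl by blast
    show "N (Suc n) \<inter> B \<noteq> {}" for n using F(3) FB by blast
    show "N (Suc (Suc n)) \<inter> B \<subseteq> N (Suc n) \<inter> B" for n using N(3) by blast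
  qed
  then obtain a where a: "\<And>n. a \<in> N (Suc n) \<inter> B" by blast
  have aA: "a \<in> topspace TA" using a[of 0] by (simp add: B_def)
  have cl: "closedin TG (topspace TG - O1)" using C1(1) by blast
  have "d a (x m) (y m) \<in> topspace TG - O1" for m
    using dN[of a m] a[of m] C1(4) \<phi>G[OF aA] xyK ts by (auto simp: d_def)
  then have "d a x' y' \<in> topspace TG - O1"
    by (intro limit[OF cl aA, of 0])
  moreover have "d a x' y' \<in> O1" using a[of 0] C0(5) by (auto simp: B_def)
  ultimately show False by blast
qed

text \<open>
  Near \<open>(a0, x0)\<close> write \<open>\<phi> a x = \<phi> a0 x0 + (\<phi> a0 x - \<phi> a0 x0) + \<phi> (a - a0) x\<close>. The middle term is small by
  continuity in \<open>x\<close>. The last one equals \<open>\<phi> (b + (a - a0)) x - \<phi> b x\<close> for every \<open>b\<close>, hence is small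
  uniformly in \<open>x\<close> when \<open>b\<close> is a point of small oscillation.
\<close>

lemma additive_separately_continuous_imp_continuous:
  assumes A: "topological_abelian_group A TA" "locally_compact_space TA" "Hausdorff_space TA"
    and K: "compact_space TK" and G: "topological_abelian_group G TG"
    and contA: "\<And>x. x \<in> topspace TK \<Longrightarrow> continuous_map TA TG (\<lambda>a. \<phi> a x)"
    and contK: "\<And>a. a \<in> topspace TA \<Longrightarrow> continuous_map TK TG (\<lambda>x. \<phi> a x)"
    and additive: "\<And>a b x. \<lbrakk>a \<in> carrier A; b \<in> carrier A; x \<in> topspace TK\<rbrakk> \<Longrightarrow>
      \<phi> (a \<oplus>\<^bsub>A\<^esub> b) x = \<phi> a x \<oplus>\<^bsub>G\<^esub> \<phi> b x"
  shows "continuous_map (prod_topology TA TK) TG (\<lambda>(a, x). \<phi> a x)"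
proof -
  interpret A: abelian_group A using topological_abelian_groupD[OF A(1)] by simp
  interpret G: abelian_group G using topological_abelian_groupD[OF G] by simp
  have tsA: "topspace TA = carrier A" using topological_abelian_groupD[OF A(1)] by simp
  have ts: "topspace TG = carrier G" using topological_abelian_groupD[OF G] by simp
  have \<phi>G: "\<phi> a x \<in> carrier G" if "a \<in> carrier A" "x \<in> topspace TK" for a x
    using continuous_map_funspace[OF contA[OF that(2)]] that tsA ts by auto
  have "\<exists>T. openin (prod_topology TA TK) T \<and> (a0, x0) \<in> T \<and> (\<forall>(a, x)\<in>T. \<phi> a x \<in> W)"
    if W: "openin TG W" and a0: "a0 \<in> carrier A" and x0: "x0 \<in> topspace TK" and in_W: "\<phi> a0 x0 \<in> W"
    for W a0 x0
  proof -
    have "continuous_map (prod_topology TG TG) TG (\<lambda>p. \<phi> a0 x0 \<oplus>\<^bsub>G\<^esub> (fst p \<oplus>\<^bsub>G\<^esub> snd p))"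
      using \<phi>G[OF a0 x0] ts
      by (intro continuous_map_group_add[OF G] continuous_map_fst continuous_map_snd) auto
    then have "openin (prod_topology TG TG)
        {p \<in> topspace (prod_topology TG TG). \<phi> a0 x0 \<oplus>\<^bsub>G\<^esub> (fst p \<oplus>\<^bsub>G\<^esub> snd p) \<in> W}" (is "openin _ ?S")
      using W openin_continuous_map_preimage by blast
    moreover have "(\<zero>\<^bsub>G\<^esub>, \<zero>\<^bsub>G\<^esub>) \<in> ?S" using ts in_W \<phi>G[OF a0 x0] by simp
    ultimately obtain P Q where PQ: "openin TG P" "openin TG Q" "\<zero>\<^bsub>G\<^esub> \<in> P" "\<zero>\<^bsub>G\<^esub> \<in> Q" "P \<times> Q \<subseteq> ?S"
      unfolding openin_prod_topology_alt by meson
    have "openin TA (topspace TA)" "topspace TA \<noteq> {}" using openin_topspace[of TA] a0 tsA by auto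
    then obtain b U' where b: "b \<in> topspace TA" "openin TA U'" "b \<in> U'"
      and small: "\<And>a x. \<lbrakk>a \<in> U'; x \<in> topspace TK\<rbrakk> \<Longrightarrow> \<phi> a x \<ominus>\<^bsub>G\<^esub> \<phi> b x \<in> Q"
      using separately_continuous_small_oscillation[OF A(2)
          locally_compact_Hausdorff_imp_regular_space[OF A(2,3)] K G contA contK _ _ PQ(2,4)]
      by (metis (no_types, lifting))
    define U where "U = {a \<in> topspace TA. b \<oplus>\<^bsub>A\<^esub> (a \<ominus>\<^bsub>A\<^esub> a0) \<in> U'}"
    have "continuous_map TA TA (\<lambda>a. b \<oplus>\<^bsub>A\<^esub> (a \<ominus>\<^bsub>A\<^esub> a0))"
      using a0 b(1) tsA by (intro continuous_map_group_add[OF A(1)] continuous_map_group_diff[OF A(1)]) auto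
    then have openU: "openin TA U"
      unfolding U_def using b(2) openin_continuous_map_preimage by blast
    have a0U: "a0 \<in> U" using a0 b tsA by (simp add: U_def A.diff_self)
    define O' where "O' = {x \<in> topspace TK. \<phi> a0 x \<ominus>\<^bsub>G\<^esub> \<phi> a0 x0 \<in> P}"
    have "continuous_map TK TG (\<lambda>x. \<phi> a0 x \<ominus>\<^bsub>G\<^esub> \<phi> a0 x0)"
      using a0 x0 tsA ts \<phi>G by (intro continuous_map_group_diff[OF G] contK) auto
    then have openO: "openin TK O'"
      unfolding O'_def using PQ(1) openin_continuous_map_preimage by blast
    have x0O: "x0 \<in> O'" using x0 PQ \<phi>G[OF a0 x0] by (simp add: O'_def G.diff_self)
    have "\<phi> a x \<in> W" if a: "a \<in> U" and x: "x \<in> O'" for a x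
    proof -
      define t where "t = a \<ominus>\<^bsub>A\<^esub> a0"
      have aA: "a \<in> carrier A" and xK: "x \<in> topspace TK" using a x tsA by (auto simp: U_def O'_def)
      have tA: "t \<in> carrier A" and a_eq: "a = a0 \<oplus>\<^bsub>A\<^esub> t"
        using aA a0 A.a_lcomm[of a0 a "\<ominus>\<^bsub>A\<^esub> a0"] by (simp_all add: t_def a_minus_def A.r_neg)
      have "\<phi> (b \<oplus>\<^bsub>A\<^esub> t) x \<ominus>\<^bsub>G\<^esub> \<phi> b x \<in> Q"
        using a small xK by (simp add: U_def t_def)
      moreover have "\<phi> (b \<oplus>\<^bsub>A\<^esub> t) x \<ominus>\<^bsub>G\<^esub> \<phi> b x = \<phi> t x"
        using additive[of b t x] b(1) tA xK tsA \<phi>G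
        by (simp add: a_minus_def G.a_comm G.r_neg1)
      moreover have "\<phi> a0 x \<ominus>\<^bsub>G\<^esub> \<phi> a0 x0 \<in> P" using x by (simp add: O'_def)
      ultimately have "(\<phi> a0 x \<ominus>\<^bsub>G\<^esub> \<phi> a0 x0, \<phi> t x) \<in> ?S" using PQ(5) by auto
      then have "\<phi> a0 x0 \<oplus>\<^bsub>G\<^esub> ((\<phi> a0 x \<ominus>\<^bsub>G\<^esub> \<phi> a0 x0) \<oplus>\<^bsub>G\<^esub> \<phi> t x) \<in> W" by simp
      moreover have "\<phi> a0 x0 \<oplus>\<^bsub>G\<^esub> ((\<phi> a0 x \<ominus>\<^bsub>G\<^esub> \<phi> a0 x0) \<oplus>\<^bsub>G\<^esub> \<phi> t x) = \<phi> a x"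
      proof -
        have "\<phi> a0 x0 \<oplus>\<^bsub>G\<^esub> (\<phi> a0 x \<ominus>\<^bsub>G\<^esub> \<phi> a0 x0) = \<phi> a0 x"
          using \<phi>G[OF a0 x0] \<phi>G[OF a0 xK]
          by (simp add: a_minus_def G.a_comm[of "\<phi> a0 x"] G.r_neg2)
        then show ?thesis
          using \<phi>G a0 x0 xK tA additive[OF a0 tA xK]
          by (simp add: a_eq flip: G.a_assoc)
      qed
      ultimately show ?thesis by simp
    qed
    then show ?thesis
      using openU a0U openO x0O
      by (intro exI[of _ "U \<times> O'"]) (auto simp: openin_prod_Times_iff)
  qed
  note nbd = this
  have "openin (prod_topology TA TK) {p \<in> topspace (prod_topology TA TK). (\<lambda>(a, x). \<phi> a x) p \<in> W}"
    (is "openin _ ?S") if W: "openin TG W" for W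
  proof (subst openin_subopen, rule ballI)
    fix p assume p: "p \<in> ?S"
    then obtain T where T: "openin (prod_topology TA TK) T" "p \<in> T" "\<forall>(a, x)\<in>T. \<phi> a x \<in> W"
      using nbd[OF W, of "fst p" "snd p"] tsA by (auto simp: split_beta)
    then have "T \<subseteq> ?S" using openin_subset[OF T(1)] by (auto simp: split_beta)
    then show "\<exists>T. openin (prod_topology TA TK) T \<and> p \<in> T \<and> T \<subseteq> ?S" using T by blast
  qed
  then show ?thesis
    using \<phi>G tsA ts unfolding continuous_map_def by auto
qed

section \<open>Left modules\<close>

context left_module
begin

lemma smult_l_null:
  assumes "x \<in> carrier M"
  shows "\<zero>\<^bsub>R\<^esub> \<odot>\<^bsub>M\<^esub> x = \<zero>\<^bsub>M\<^esub>"
proof -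
  have "\<zero>\<^bsub>R\<^esub> \<odot>\<^bsub>M\<^esub> x \<oplus>\<^bsub>M\<^esub> \<zero>\<^bsub>R\<^esub> \<odot>\<^bsub>M\<^esub> x = \<zero>\<^bsub>R\<^esub> \<odot>\<^bsub>M\<^esub> x"
    using smult_l_distr[of "\<zero>\<^bsub>R\<^esub>" "\<zero>\<^bsub>R\<^esub>" x] assms by simp
  then show ?thesis
    using smult_closed[OF R.zero_closed assms] M.add.r_cancel_one' by metis
qed

lemma smult_r_null:
  assumes "a \<in> carrier R"
  shows "a \<odot>\<^bsub>M\<^esub> \<zero>\<^bsub>M\<^esub> = \<zero>\<^bsub>M\<^esub>"
proof -
  have "a \<odot>\<^bsub>M\<^esub> \<zero>\<^bsub>M\<^esub> \<oplus>\<^bsub>M\<^esub> a \<odot>\<^bsub>M\<^esub> \<zero>\<^bsub>M\<^esub> = a \<odot>\<^bsub>M\<^esub> \<zero>\<^bsub>M\<^esub>"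
    using smult_r_distr[of a "\<zero>\<^bsub>M\<^esub>" "\<zero>\<^bsub>M\<^esub>"] assms by simp
  then show ?thesis
    using smult_closed[OF assms M.zero_closed] M.add.r_cancel_one' by metis
qed

lemma smult_minus_one:
  assumes "x \<in> carrier M"
  shows "(\<ominus>\<^bsub>R\<^esub> \<one>\<^bsub>R\<^esub>) \<odot>\<^bsub>M\<^esub> x = \<ominus>\<^bsub>M\<^esub> x"
proof -
  have "(\<ominus>\<^bsub>R\<^esub> \<one>\<^bsub>R\<^esub>) \<odot>\<^bsub>M\<^esub> x \<oplus>\<^bsub>M\<^esub> x = (\<ominus>\<^bsub>R\<^esub> \<one>\<^bsub>R\<^esub> \<oplus>\<^bsub>R\<^esub> \<one>\<^bsub>R\<^esub>) \<odot>\<^bsub>M\<^esub> x"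
    using assms by (simp add: smult_l_distr smult_one)
  also have "\<dots> = \<zero>\<^bsub>M\<^esub>" using assms by (simp add: R.l_neg smult_l_null)
  finally show ?thesis
    using M.minus_equality assms smult_closed by simp
qed

text \<open>
  Closure under negation is automatic in a module, since \<open>-x = (-1)x\<close>; closure under zero follows
  from \<open>0 = 0x\<close>.
\<close>

lemma left_submoduleI:
  assumes "E \<subseteq> carrier M" "E \<noteq> {}"
    and "\<And>x y. \<lbrakk>x \<in> E; y \<in> E\<rbrakk> \<Longrightarrow> x \<oplus>\<^bsub>M\<^esub> y \<in> E"
    and smult: "\<And>a x. \<lbrakk>a \<in> carrier R; x \<in> E\<rbrakk> \<Longrightarrow> a \<odot>\<^bsub>M\<^esub> x \<in> E"
  shows "submodule E R M"
proof (intro submodule.intro submodule_axioms.intro subgroup.intro)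
  show "inv\<^bsub>add_monoid M\<^esub> x \<in> E" if "x \<in> E" for x
    using smult[of "\<ominus>\<^bsub>R\<^esub> \<one>\<^bsub>R\<^esub>" x] smult_minus_one[of x] that assms(1) by (auto simp: a_inv_def)
  obtain x where "x \<in> E" using assms(2) by blast
  then show "\<one>\<^bsub>add_monoid M\<^esub> \<in> E"
    using smult[of "\<zero>\<^bsub>R\<^esub>" x] smult_l_null[of x] assms(1) by auto
qed (use assms in auto)

lemma left_submoduleD:
  assumes "submodule E R M"
  shows "E \<subseteq> carrier M" "\<zero>\<^bsub>M\<^esub> \<in> E"
    "\<And>x y. \<lbrakk>x \<in> E; y \<in> E\<rbrakk> \<Longrightarrow> x \<oplus>\<^bsub>M\<^esub> y \<in> E"
    "\<And>a x. \<lbrakk>a \<in> carrier R; x \<in> E\<rbrakk> \<Longrightarrow> a \<odot>\<^bsub>M\<^esub> x \<in> E"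
    "\<And>x. x \<in> E \<Longrightarrow> \<ominus>\<^bsub>M\<^esub> x \<in> E"
proof -
  interpret submodule E R M by fact
  show "E \<subseteq> carrier M" "\<zero>\<^bsub>M\<^esub> \<in> E"
    "\<And>x y. \<lbrakk>x \<in> E; y \<in> E\<rbrakk> \<Longrightarrow> x \<oplus>\<^bsub>M\<^esub> y \<in> E"
    "\<And>a x. \<lbrakk>a \<in> carrier R; x \<in> E\<rbrakk> \<Longrightarrow> a \<odot>\<^bsub>M\<^esub> x \<in> E"
    "\<And>x. x \<in> E \<Longrightarrow> \<ominus>\<^bsub>M\<^esub> x \<in> E"
    using subset one_closed m_closed smult_closed m_inv_closed by (auto simp: a_inv_def)
qed

lemma submodule_carrier: "submodule (carrier M) R M"
  by (rule left_submoduleI) (use M.zero_closed smult_closed in auto)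

lemma smult_finsum:
  assumes "a \<in> carrier R" "finite A" "g \<in> A \<rightarrow> carrier M"
  shows "a \<odot>\<^bsub>M\<^esub> (finsum M g A) = finsum M (\<lambda>x. a \<odot>\<^bsub>M\<^esub> g x) A"
  using assms(2,3)
proof (induction A rule: finite_induct)
  case empty
  then show ?case using assms(1) by (simp add: smult_r_null)
next
  case (insert x A)
  then have "g x \<in> carrier M" "g \<in> A \<rightarrow> carrier M" by auto
  moreover have "(\<lambda>x. a \<odot>\<^bsub>M\<^esub> g x) \<in> A \<rightarrow> carrier M"
    using insert.prems assms(1) smult_closed by auto
  ultimately show ?case
    using insert assms(1) by (simp add: smult_closed smult_r_distr)
qed

end

definition finitely_supported_functions :: "('r, 'a) ring_scheme \<Rightarrow> 'x set \<Rightarrow> ('x \<Rightarrow> 'r) set" where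
  "finitely_supported_functions R S =
     {c. c \<in> UNIV \<rightarrow> carrier R \<and> finite {x. c x \<noteq> \<zero>\<^bsub>R\<^esub>} \<and> {x. c x \<noteq> \<zero>\<^bsub>R\<^esub>} \<subseteq> S}"

text \<open>
  Coefficients are total functions that vanish outside a finite set, so that the span of a family
  indexed by \<open>S\<close> is the image of a set of functions of type \<open>'x \<Rightarrow> 'r\<close>. This bounds the size of the span
  by a type that does not mention the module.
\<close>

definition linear_combination ::
  "('r, 'a) ring_scheme \<Rightarrow> ('r, 'm, 'c) module_scheme \<Rightarrow> ('x \<Rightarrow> 'm) \<Rightarrow> ('x \<Rightarrow> 'r) \<Rightarrow> 'm"
where
  "linear_combination R M f c = finsum M (\<lambda>x. c x \<odot>\<^bsub>M\<^esub> f x) {x. c x \<noteq> \<zero>\<^bsub>R\<^esub>}"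

lemma (in left_module) submodule_linear_combinations:
  assumes f: "f \<in> S \<rightarrow> carrier M"
  defines "E \<equiv> linear_combination R M f ` finitely_supported_functions R S"
  shows "submodule E R M" "f ` S \<subseteq> E"
proof -
  let ?F = "finitely_supported_functions R S"
  have F: "c x \<in> carrier R" "finite {x. c x \<noteq> \<zero>\<^bsub>R\<^esub>}" "{x. c x \<noteq> \<zero>\<^bsub>R\<^esub>} \<subseteq> S" if "c \<in> ?F" for c x
    using that by (auto simp: finitely_supported_functions_def)
  have term_closed: "(\<lambda>x. c x \<odot>\<^bsub>M\<^esub> f x) \<in> A \<rightarrow> carrier M" if "c \<in> ?F" "A \<subseteq> S" for c A
    using F(1)[OF that(1)] that(2) f smult_closed by blast
  have lc_eq: "linear_combination R M f c = finsum M (\<lambda>x. c x \<odot>\<^bsub>M\<^esub> f x) A"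
    if c: "c \<in> ?F" and A: "finite A" "{x. c x \<noteq> \<zero>\<^bsub>R\<^esub>} \<subseteq> A" "A \<subseteq> S" for c A
    unfolding linear_combination_def
  proof (rule M.add.finprod_mono_neutral_cong_left)
    show "c x \<odot>\<^bsub>M\<^esub> f x = \<zero>\<^bsub>M\<^esub>" if "x \<in> A - {x. c x \<noteq> \<zero>\<^bsub>R\<^esub>}" for x
      using that A f smult_l_null[of "f x"] by auto
  qed (use A term_closed[OF c] in auto)
  show "submodule E R M"
  proof (rule left_submoduleI)
    show "E \<subseteq> carrier M"
      using term_closed F(3) by (auto simp: E_def linear_combination_def intro!: M.finsum_closed)
    have "(\<lambda>x. \<zero>\<^bsub>R\<^esub>) \<in> ?F" by (simp add: finitely_supported_functions_def)
    then show "E \<noteq> {}" unfolding E_def by blast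
  next
    fix u v assume "u \<in> E" "v \<in> E"
    then obtain c d where c: "c \<in> ?F" "u = linear_combination R M f c"
      and d: "d \<in> ?F" "v = linear_combination R M f d" by (auto simp: E_def)
    define A where "A = {x. c x \<noteq> \<zero>\<^bsub>R\<^esub>} \<union> {x. d x \<noteq> \<zero>\<^bsub>R\<^esub>}"
    have A: "finite A" "A \<subseteq> S" using F(2,3) c d by (auto simp: A_def)
    have supp: "{x. c x \<oplus>\<^bsub>R\<^esub> d x \<noteq> \<zero>\<^bsub>R\<^esub>} \<subseteq> A" by (auto simp: A_def)
    have e: "(\<lambda>x. c x \<oplus>\<^bsub>R\<^esub> d x) \<in> ?F"
      using supp A F(1)[OF c(1)] F(1)[OF d(1)] finite_subset[OF supp]
      by (auto simp: finitely_supported_functions_def)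
    have "linear_combination R M f (\<lambda>x. c x \<oplus>\<^bsub>R\<^esub> d x) = finsum M (\<lambda>x. (c x \<oplus>\<^bsub>R\<^esub> d x) \<odot>\<^bsub>M\<^esub> f x) A"
      by (rule lc_eq[OF e A(1) supp A(2)])
    also have "\<dots> = finsum M (\<lambda>x. c x \<odot>\<^bsub>M\<^esub> f x \<oplus>\<^bsub>M\<^esub> d x \<odot>\<^bsub>M\<^esub> f x) A"
    proof (rule M.finsum_cong')
      show "(\<lambda>x. c x \<odot>\<^bsub>M\<^esub> f x \<oplus>\<^bsub>M\<^esub> d x \<odot>\<^bsub>M\<^esub> f x) \<in> A \<rightarrow> carrier M"
        using term_closed[OF c(1) A(2)] term_closed[OF d(1) A(2)] by auto
      show "(c x \<oplus>\<^bsub>R\<^esub> d x) \<odot>\<^bsub>M\<^esub> f x = c x \<odot>\<^bsub>M\<^esub> f x \<oplus>\<^bsub>M\<^esub> d x \<odot>\<^bsub>M\<^esub> f x" if "x \<in> A" for x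
        using that A f F(1)[OF c(1)] F(1)[OF d(1)] by (intro smult_l_distr) auto
    qed simp
    also have "\<dots> = u \<oplus>\<^bsub>M\<^esub> v"
      using lc_eq[OF c(1) A(1) _ A(2)] lc_eq[OF d(1) A(1) _ A(2)] c d
        M.finsum_addf[OF term_closed[OF c(1) A(2)] term_closed[OF d(1) A(2)]]
      by (simp add: A_def)
    finally show "u \<oplus>\<^bsub>M\<^esub> v \<in> E" using e unfolding E_def by (metis image_eqI)
  next
    fix a u assume a: "a \<in> carrier R" and "u \<in> E"
    then obtain c where c: "c \<in> ?F" "u = linear_combination R M f c" by (auto simp: E_def)
    define A where "A = {x. c x \<noteq> \<zero>\<^bsub>R\<^esub>}"
    have A: "finite A" "A \<subseteq> S" using F(2,3) c by (auto simp: A_def)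
    have supp: "{x. a \<otimes>\<^bsub>R\<^esub> c x \<noteq> \<zero>\<^bsub>R\<^esub>} \<subseteq> A" using a by (auto simp: A_def)
    have e: "(\<lambda>x. a \<otimes>\<^bsub>R\<^esub> c x) \<in> ?F"
      using supp A a F(1)[OF c(1)] finite_subset[OF supp]
      by (auto simp: finitely_supported_functions_def)
    have "linear_combination R M f (\<lambda>x. a \<otimes>\<^bsub>R\<^esub> c x) = finsum M (\<lambda>x. (a \<otimes>\<^bsub>R\<^esub> c x) \<odot>\<^bsub>M\<^esub> f x) A"
      by (rule lc_eq[OF e A(1) supp A(2)])
    also have "\<dots> = finsum M (\<lambda>x. a \<odot>\<^bsub>M\<^esub> (c x \<odot>\<^bsub>M\<^esub> f x)) A"
    proof (rule M.finsum_cong')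
      show "(\<lambda>x. a \<odot>\<^bsub>M\<^esub> (c x \<odot>\<^bsub>M\<^esub> f x)) \<in> A \<rightarrow> carrier M"
        using term_closed[OF c(1) A(2)] a smult_closed by auto
      show "(a \<otimes>\<^bsub>R\<^esub> c x) \<odot>\<^bsub>M\<^esub> f x = a \<odot>\<^bsub>M\<^esub> (c x \<odot>\<^bsub>M\<^esub> f x)" if "x \<in> A" for x
        using that A f a F(1)[OF c(1)] by (intro smult_assoc1) auto
    qed simp
    also have "\<dots> = a \<odot>\<^bsub>M\<^esub> u"
      using smult_finsum[OF a A(1) term_closed[OF c(1) A(2)]] c
      by (simp add: A_def linear_combination_def)
    finally show "a \<odot>\<^bsub>M\<^esub> u \<in> E" using e unfolding E_def by (metis image_eqI)
  qed
  show "f ` S \<subseteq> E"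
  proof clarify
    fix x assume x: "x \<in> S"
    define c where "c y = (if y = x then \<one>\<^bsub>R\<^esub> else \<zero>\<^bsub>R\<^esub>)" for y
    have supp: "{y. c y \<noteq> \<zero>\<^bsub>R\<^esub>} \<subseteq> {x}" by (auto simp: c_def)
    have c: "c \<in> ?F"
      using x finite_subset[OF supp] supp by (auto simp: finitely_supported_functions_def c_def)
    have "linear_combination R M f c = finsum M (\<lambda>y. c y \<odot>\<^bsub>M\<^esub> f y) {x}"
      by (rule lc_eq[OF c _ supp]) (use x in auto)
    also have "\<dots> = c x \<odot>\<^bsub>M\<^esub> f x"
      using term_closed[OF c, of "{x}"] x by (simp add: M.finsum_insert)
    also have "\<dots> = f x" using funcset_mem[OF f x] by (simp add: c_def smult_one)
    finally show "f x \<in> E" using c unfolding E_def by (metis image_eqI)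
  qed
qed

section \<open>Topological rings and modules\<close>

lemma topological_ring_imp_topological_abelian_group:
  assumes "topological_ring R TR"
  shows "topological_abelian_group R TR"
proof -
  interpret ring R using assms by (simp add: topological_ring_def)
  have ts: "topspace TR = carrier R" using assms by (simp add: topological_ring_def)
  have "continuous_map TR TR ((\<lambda>(x, y). x \<otimes>\<^bsub>R\<^esub> y) \<circ> (\<lambda>z. (\<ominus>\<^bsub>R\<^esub> \<one>\<^bsub>R\<^esub>, z)))"
    using assms ts by (intro continuous_map_compose[of _ "prod_topology TR TR"])
      (auto simp: topological_ring_def continuous_map_paired)
  then have "continuous_map TR TR (\<lambda>z. \<ominus>\<^bsub>R\<^esub> z)"
    by (rule continuous_map_eq) (simp add: ts l_minus)
  then show ?thesis
    using assms abelian_group_axioms by (simp add: topological_abelian_group_def topological_ring_def)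
qed

lemma semitopological_moduleD:
  assumes "semitopological_module R TR M TM"
  shows "left_module R M" "topological_abelian_group M TM" "Hausdorff_space TM"
    "topspace TM = carrier M"
    "\<And>a. a \<in> carrier R \<Longrightarrow> continuous_map TM TM (\<lambda>x. a \<odot>\<^bsub>M\<^esub> x)"
    "\<And>x. x \<in> carrier M \<Longrightarrow> continuous_map TR TM (\<lambda>a. a \<odot>\<^bsub>M\<^esub> x)"
  using assms by (auto simp: semitopological_module_def topological_abelian_group_def)

lemma topological_ringD:
  assumes "topological_ring R TR"
  shows "ring R" "topspace TR = carrier R" "Hausdorff_space TR"
  using assms by (auto simp: topological_ring_def)

lemma topological_module_imp_semitopological_module:
  assumes "topspace TR = carrier R" and M: "topological_module R TR M TM"
  shows "semitopological_module R TR M TM"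
proof -
  have tsM: "topspace TM = carrier M" and cont: "continuous_map (prod_topology TR TM) TM (\<lambda>(a, x). a \<odot>\<^bsub>M\<^esub> x)"
    using M by (auto simp: topological_module_def topological_abelian_group_def)
  have "continuous_map TM TM (\<lambda>x. a \<odot>\<^bsub>M\<^esub> x)" if "a \<in> carrier R" for a
    using continuous_map_compose[OF _ cont, of TM "\<lambda>x. (a, x)"] that assms(1)
    by (simp add: o_def continuous_map_paired)
  moreover have "continuous_map TR TM (\<lambda>a. a \<odot>\<^bsub>M\<^esub> x)" if "x \<in> carrier M" for x
    using continuous_map_compose[OF _ cont, of TR "\<lambda>a. (a, x)"] that tsM
    by (simp add: o_def continuous_map_paired)
  ultimately show ?thesis
    using M by (simp add: topological_module_def semitopological_module_def)
qed

text \<open>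
  The product of a locally compact Hausdorff space with a k-space is a k-space, so continuity has to be
  checked on compact subsets of the product only. Each of them lies in \<open>R \<times> K\<close> for its compact
  projection \<open>K\<close>, where separate continuity and additivity suffice.
\<close>

lemma continuous_map_smult_k_space:
  assumes R: "topological_ring R TR" "locally_compact_space TR"
    and M: "semitopological_module R TR M TM"
    and X: "k_space X" and f: "continuous_map X TM f"
  shows "continuous_map (prod_topology TR X) TM (\<lambda>(a, x). a \<odot>\<^bsub>M\<^esub> f x)"
proof (rule continuous_map_from_k_space)
  interpret left_module R M using semitopological_moduleD[OF M] by simp
  have tsR: "topspace TR = carrier R" using topological_ringD[OF R(1)] by simp
  have fM: "f x \<in> carrier M" if "x \<in> topspace X" for x
    using continuous_map_funspace[OF f] that semitopological_moduleD(4)[OF M] by auto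
  show "k_space (prod_topology TR X)"
    using topological_ringD[OF R(1)] R(2) X by (intro k_space_prod_topology_left) auto
  fix C assume C: "compactin (prod_topology TR X) C"
  define K where "K = snd ` C"
  have KX: "compactin X K"
    unfolding K_def using C continuous_map_snd by (rule image_compactin)
  then have "K \<subseteq> topspace X" by (rule compactin_subset_topspace)
  have "continuous_map (prod_topology TR (subtopology X K)) TM (\<lambda>(a, x). a \<odot>\<^bsub>M\<^esub> f x)"
  proof (rule additive_separately_continuous_imp_continuous)
    show "topological_abelian_group R TR"
      using R by (simp add: topological_ring_imp_topological_abelian_group)
    show "Hausdorff_space TR" using topological_ringD[OF R(1)] by simp
    show "compact_space (subtopology X K)" using KX by (simp add: compactin_subspace)
    show "continuous_map TR TM (\<lambda>a. a \<odot>\<^bsub>M\<^esub> f x)" if "x \<in> topspace (subtopology X K)" for x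
      using that fM semitopological_moduleD(6)[OF M] by simp
    show "continuous_map (subtopology X K) TM (\<lambda>x. a \<odot>\<^bsub>M\<^esub> f x)" if "a \<in> topspace TR" for a
      using continuous_map_compose[OF f semitopological_moduleD(5)[OF M, of a]] that tsR
      by (simp add: o_def continuous_map_from_subtopology)
  qed (use R semitopological_moduleD[OF M] fM smult_l_distr in auto)
  then have "continuous_map (subtopology (prod_topology TR X) (topspace TR \<times> K)) TM (\<lambda>(a, x). a \<odot>\<^bsub>M\<^esub> f x)"
    by (simp add: subtopology_Times)
  then show "continuous_map (subtopology (prod_topology TR X) C) TM (\<lambda>(a, x). a \<odot>\<^bsub>M\<^esub> f x)"
    by (rule continuous_map_from_subtopology_mono)
      (use compactin_subset_topspace[OF C] in \<open>force simp: K_def\<close>)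
qed

section \<open>The compact-open topology on a module\<close>

text \<open>
  The topology induced by the compact-open topology on the functions from \<open>R\<close> to \<open>M\<close> along
  \<open>m \<mapsto> (\<lambda>a. a \<odot> m)\<close>.
\<close>

definition compact_open_module_topology ::
  "('r, 'a) ring_scheme \<Rightarrow> 'r topology \<Rightarrow> ('r, 'm, 'c) module_scheme \<Rightarrow> 'm topology \<Rightarrow> 'm topology"
where
  "compact_open_module_topology R TR M TM =
     topology_generated_by
       {{m \<in> carrier M. \<forall>a\<in>C. a \<odot>\<^bsub>M\<^esub> m \<in> W} | C W. compactin TR C \<and> openin TM W}"

text \<open>
  The empty compact set contributes the whole carrier to the subbase.
\<close>

lemma topspace_compact_open_module_topology:
  "topspace (compact_open_module_topology R TR M TM) = carrier M"
proof -
  have "carrier M \<in> {{m \<in> carrier M. \<forall>a\<in>C. a \<odot>\<^bsub>M\<^esub> m \<in> W} | C W. compactin TR C \<and> openin TM W}"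
    by (rule CollectI, intro exI[of _ "{}"]) auto
  then show ?thesis
    unfolding compact_open_module_topology_def topology_generated_by_topspace by blast
qed

text \<open>
  Currying: the tube lemma turns a neighbourhood of \<open>C \<times> {z}\<close> into one of \<open>z\<close>.
\<close>

lemma continuous_map_into_compact_open_module_topology:
  assumes h: "h \<in> topspace Z \<rightarrow> carrier M"
    and cont: "continuous_map (prod_topology TR Z) TM (\<lambda>(a, z). a \<odot>\<^bsub>M\<^esub> h z)"
  shows "continuous_map Z (compact_open_module_topology R TR M TM) h"
  unfolding compact_open_module_topology_def
proof (rule continuous_on_generated_topo)
  fix U assume "U \<in> {{m \<in> carrier M. \<forall>a\<in>C. a \<odot>\<^bsub>M\<^esub> m \<in> W} | C W. compactin TR C \<and> openin TM W}"
  then obtain C W where U: "U = {m \<in> carrier M. \<forall>a\<in>C. a \<odot>\<^bsub>M\<^esub> m \<in> W}"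
    and C: "compactin TR C" and W: "openin TM W" by blast
  let ?S = "{p \<in> topspace (prod_topology TR Z). (\<lambda>(a, z). a \<odot>\<^bsub>M\<^esub> h z) p \<in> W}"
  have S: "openin (prod_topology TR Z) ?S"
    using cont W openin_continuous_map_preimage by blast
  show "openin Z (h -` U \<inter> topspace Z)"
  proof (subst openin_subopen, safe)
    fix z assume z: "z \<in> topspace Z" "h z \<in> U"
    have "C \<times> {z} \<subseteq> ?S"
      using z compactin_subset_topspace[OF C] by (auto simp: U)
    then obtain V T where "openin TR V" "openin Z T" "C \<subseteq> V" "z \<in> T" "V \<times> T \<subseteq> ?S"
      using tube_lemma_left[OF S C z(1)] by meson
    moreover from this have "T \<subseteq> h -` U \<inter> topspace Z"
      using h openin_subset[of Z T] by (fastforce simp: U)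
    ultimately show "\<exists>T. openin Z T \<and> z \<in> T \<and> T \<subseteq> h -` U \<inter> topspace Z" by blast
  qed
next
  have "\<Union>{{m \<in> carrier M. \<forall>a\<in>C. a \<odot>\<^bsub>M\<^esub> m \<in> W} | C W. compactin TR C \<and> openin TM W} = carrier M"
    using topspace_compact_open_module_topology[of R TR M TM]
    unfolding compact_open_module_topology_def topology_generated_by_topspace .
  then show "h ` topspace Z \<subseteq> \<Union>{{m \<in> carrier M. \<forall>a\<in>C. a \<odot>\<^bsub>M\<^esub> m \<in> W} | C W. compactin TR C \<and> openin TM W}"
    using h by blast
qed

text \<open>
  Evaluation is jointly continuous because a point of \<open>R\<close> has arbitrarily small compact neighbourhoods
  \<open>C\<close>, and the set of all \<open>m\<close> with \<open>C \<odot> m \<subseteq> W\<close> is open by definition.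
\<close>

lemma continuous_map_smult_compact_open_module_topology:
  assumes R: "topological_ring R TR" "locally_compact_space TR"
    and M: "semitopological_module R TR M TM"
  shows "continuous_map (prod_topology TR (compact_open_module_topology R TR M TM)) TM
           (\<lambda>(a, m). a \<odot>\<^bsub>M\<^esub> m)"
proof -
  interpret left_module R M using semitopological_moduleD[OF M] by simp
  let ?T = "compact_open_module_topology R TR M TM"
  have tsR: "topspace TR = carrier R" using topological_ringD[OF R(1)] by simp
  note tsM = semitopological_moduleD(4)[OF M]
  note tsT = topspace_compact_open_module_topology[of R TR M TM]
  have nbR: "neighbourhood_base_of (compactin TR) TR"
    using R topological_ringD[OF R(1)] locally_compact_space_neighbourhood_base by blast
  have "\<exists>T. openin (prod_topology TR ?T) T \<and> (a, m) \<in> T \<and>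
      T \<subseteq> {p \<in> topspace (prod_topology TR ?T). (\<lambda>(a, m). a \<odot>\<^bsub>M\<^esub> m) p \<in> W}"
    if W: "openin TM W" and a: "a \<in> carrier R" and m: "m \<in> carrier M" and am: "a \<odot>\<^bsub>M\<^esub> m \<in> W" for W a m
  proof -
    have "openin TR {a \<in> topspace TR. a \<odot>\<^bsub>M\<^esub> m \<in> W}"
      using semitopological_moduleD(6)[OF M m] W openin_continuous_map_preimage by blast
    moreover have "a \<in> {a \<in> topspace TR. a \<odot>\<^bsub>M\<^esub> m \<in> W}" using a am tsR by simp
    ultimately obtain U C where UC: "openin TR U" "compactin TR C" "a \<in> U" "U \<subseteq> C"
        "C \<subseteq> {a \<in> topspace TR. a \<odot>\<^bsub>M\<^esub> m \<in> W}"
      using nbR unfolding neighbourhood_base_of by meson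
    let ?N = "{m \<in> carrier M. \<forall>a\<in>C. a \<odot>\<^bsub>M\<^esub> m \<in> W}"
    have "openin ?T ?N"
      unfolding compact_open_module_topology_def
      by (rule topology_generated_by_Basis) (use UC W in blast)
    moreover have "m \<in> ?N" using UC m by blast
    ultimately show ?thesis
      using UC openin_subset[OF UC(1)]
      by (intro exI[of _ "U \<times> ?N"]) (auto simp: openin_prod_Times_iff tsT)
  qed
  note nbd = this
  have "openin (prod_topology TR ?T) {p \<in> topspace (prod_topology TR ?T). (\<lambda>(a, m). a \<odot>\<^bsub>M\<^esub> m) p \<in> W}"
    if W: "openin TM W" for W
    using nbd[OF W] by (subst openin_subopen) (auto simp: tsT tsR)
  then show ?thesis
    using smult_closed tsR tsT tsM unfolding continuous_map_def by auto
qed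

text \<open>
  Currying and evaluation reduce each continuity statement about the compact-open topology to one
  about \<open>M\<close>; for example, addition is continuous since \<open>a \<odot> (m + n) = a \<odot> m + a \<odot> n\<close> depends
  continuously on \<open>a\<close>, \<open>m\<close>, \<open>n\<close>, and the map \<open>b \<mapsto> b \<odot> m\<close> since \<open>a \<odot> (b \<odot> m) = (ab) \<odot> m\<close>.
\<close>

lemma semitopological_module_compact_open:
  assumes R: "topological_ring R TR" "locally_compact_space TR"
    and M: "semitopological_module R TR M TM"
  defines "T \<equiv> compact_open_module_topology R TR M TM"
  shows "continuous_map T TM (\<lambda>m. m)" "semitopological_module R TR M T"
proof -
  interpret left_module R M using semitopological_moduleD[OF M] by simp
  have tsR: "topspace TR = carrier R" using topological_ringD[OF R(1)] by simp
  note tsM = semitopological_moduleD(4)[OF M] and G = semitopological_moduleD(2)[OF M]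
  have tsT: "topspace T = carrier M" by (simp add: T_def topspace_compact_open_module_topology)
  have eval: "continuous_map (prod_topology TR T) TM (\<lambda>(a, m). a \<odot>\<^bsub>M\<^esub> m)"
    unfolding T_def using R M by (rule continuous_map_smult_compact_open_module_topology)
  have eval': "continuous_map Z TM (\<lambda>z. r z \<odot>\<^bsub>M\<^esub> h z)"
    if "continuous_map Z TR r" "continuous_map Z T h" for Z :: "'z topology" and r h
    using continuous_map_compose[OF continuous_map_pairedI[OF that] eval] by (simp add: o_def)
  have into: "continuous_map Z T h"
    if "h \<in> topspace Z \<rightarrow> carrier M" "continuous_map (prod_topology TR Z) TM (\<lambda>p. fst p \<odot>\<^bsub>M\<^esub> h (snd p))"
    for Z :: "'z topology" and h
    unfolding T_def by (rule continuous_map_into_compact_open_module_topology) (use that in \<open>auto simp: split_beta'\<close>)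
  have "continuous_map T TM (\<lambda>m. \<one>\<^bsub>R\<^esub> \<odot>\<^bsub>M\<^esub> m)"
    by (rule eval') (use tsR in auto)
  then show finer: "continuous_map T TM (\<lambda>m. m)"
    by (rule continuous_map_eq) (simp add: tsT smult_one)
  have fs: "continuous_map (prod_topology TR (prod_topology T T)) T (\<lambda>p. fst (snd p))"
    "continuous_map (prod_topology TR (prod_topology T T)) T (\<lambda>p. snd (snd p))"
    using continuous_map_compose[OF continuous_map_snd continuous_map_fst, of TR T T]
      continuous_map_compose[OF continuous_map_snd continuous_map_snd, of TR T T] by (simp_all add: o_def)
  have "continuous_map (prod_topology T T) T (\<lambda>p. fst p \<oplus>\<^bsub>M\<^esub> snd p)"
  proof (rule into)
    have "continuous_map (prod_topology TR (prod_topology T T)) TM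
        (\<lambda>p. fst p \<odot>\<^bsub>M\<^esub> fst (snd p) \<oplus>\<^bsub>M\<^esub> fst p \<odot>\<^bsub>M\<^esub> snd (snd p))"
      by (intro continuous_map_group_add[OF G] eval' continuous_map_fst fs)
    then show "continuous_map (prod_topology TR (prod_topology T T)) TM
        (\<lambda>p. fst p \<odot>\<^bsub>M\<^esub> (fst (snd p) \<oplus>\<^bsub>M\<^esub> snd (snd p)))"
      by (rule continuous_map_eq) (auto simp: tsR tsT smult_r_distr)
  qed (auto simp: tsT)
  then have add: "continuous_map (prod_topology T T) T (\<lambda>(x, y). x \<oplus>\<^bsub>M\<^esub> y)"
    by (simp add: split_beta')
  have smult_r: "continuous_map T T (\<lambda>m. b \<odot>\<^bsub>M\<^esub> m)" if b: "b \<in> carrier R" for b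
  proof (rule into)
    have "continuous_map TR TR (\<lambda>a. a \<otimes>\<^bsub>R\<^esub> b)"
      using R(1) b tsR continuous_map_compose[of TR "prod_topology TR TR" "\<lambda>a. (a, b)" TR "\<lambda>(x, y). x \<otimes>\<^bsub>R\<^esub> y"]
      by (simp add: topological_ring_def continuous_map_paired o_def)
    then have "continuous_map (prod_topology TR T) TM (\<lambda>p. (fst p \<otimes>\<^bsub>R\<^esub> b) \<odot>\<^bsub>M\<^esub> snd p)"
      using continuous_map_compose[OF continuous_map_fst] by (intro eval' continuous_map_snd) (auto simp: o_def)
    then show "continuous_map (prod_topology TR T) TM (\<lambda>p. fst p \<odot>\<^bsub>M\<^esub> (b \<odot>\<^bsub>M\<^esub> snd p))"
      by (rule continuous_map_eq) (auto simp: tsR tsT b smult_assoc1)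
  qed (auto simp: tsT b smult_closed)
  have neg: "continuous_map T T (\<lambda>m. \<ominus>\<^bsub>M\<^esub> m)"
    by (rule continuous_map_eq[OF smult_r[of "\<ominus>\<^bsub>R\<^esub> \<one>\<^bsub>R\<^esub>"]]) (auto simp: tsT smult_minus_one)
  have smult_l: "continuous_map TR T (\<lambda>b. b \<odot>\<^bsub>M\<^esub> m)" if m: "m \<in> carrier M" for m
  proof (rule into)
    have "continuous_map (prod_topology TR TR) TM (\<lambda>p. (fst p \<otimes>\<^bsub>R\<^esub> snd p) \<odot>\<^bsub>M\<^esub> m)"
      using R(1) continuous_map_compose[OF _ semitopological_moduleD(6)[OF M m],
          of "prod_topology TR TR" "\<lambda>(x, y). x \<otimes>\<^bsub>R\<^esub> y"]
      by (simp add: topological_ring_def split_beta' o_def)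
    then show "continuous_map (prod_topology TR TR) TM (\<lambda>p. fst p \<odot>\<^bsub>M\<^esub> (snd p \<odot>\<^bsub>M\<^esub> m))"
      by (rule continuous_map_eq) (auto simp: tsR m smult_assoc1)
  qed (auto simp: tsR m smult_closed)
  have "Hausdorff_space T"
    by (rule Hausdorff_space_injective_preimage[OF semitopological_moduleD(3)[OF M] finer]) auto
  then show "semitopological_module R TR M T"
    unfolding semitopological_module_def topological_abelian_group_def
    using left_module_axioms M.abelian_group_axioms add neg smult_l smult_r tsT by simp
qed

section \<open>Universe independence of the universal property\<close>

text \<open>
  Transport of structure moves a submodule \<open>E\<close> of \<open>M\<close> to another carrier type, namely one for which
  the universal property is known. The operations are conjugated by \<open>inv_into E \<sigma>\<close> because \<open>\<sigma>\<close> is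
  injective on \<open>E\<close> only.
\<close>

definition transport_module :: "('r, 'm, 'c) module_scheme \<Rightarrow> 'm set \<Rightarrow> ('m \<Rightarrow> 'u) \<Rightarrow> ('r, 'u) module" where
  "transport_module M E \<sigma> =
     \<lparr>carrier = \<sigma> ` E, mult = undefined, one = undefined, zero = \<sigma> \<zero>\<^bsub>M\<^esub>,
      add = (\<lambda>u v. \<sigma> (inv_into E \<sigma> u \<oplus>\<^bsub>M\<^esub> inv_into E \<sigma> v)),
      smult = (\<lambda>a u. \<sigma> (a \<odot>\<^bsub>M\<^esub> inv_into E \<sigma> u))\<rparr>"

definition transport_topology :: "'m topology \<Rightarrow> 'm set \<Rightarrow> ('m \<Rightarrow> 'u) \<Rightarrow> 'u topology" where
  "transport_topology TM E \<sigma> = pullback_topology (\<sigma> ` E) (inv_into E \<sigma>) TM"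

lemma continuous_map_into_transport_topology:
  assumes "continuous_map Z TM (\<lambda>z. inv_into E \<sigma> (h z))" "h \<in> topspace Z \<rightarrow> \<sigma> ` E"
  shows "continuous_map Z (transport_topology TM E \<sigma>) h"
  unfolding transport_topology_def
proof (rule continuous_map_pullback')
  show "topspace Z \<subseteq> h -` (\<sigma> ` E)" using assms(2) by blast
qed (use assms(1) in \<open>simp add: o_def\<close>)

lemma continuous_map_transport_topology_inverse:
  "continuous_map (transport_topology TM E \<sigma>) TM (inv_into E \<sigma>)"
  using continuous_map_pullback[OF continuous_map_id, of "\<sigma> ` E" "inv_into E \<sigma>" TM]
  by (simp add: transport_topology_def)

lemma continuous_map_into_transport_topology_o:
  assumes "continuous_map Z TM h" "h \<in> topspace Z \<rightarrow> E" "inj_on \<sigma> E"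
  shows "continuous_map Z (transport_topology TM E \<sigma>) (\<lambda>z. \<sigma> (h z))"
proof (rule continuous_map_into_transport_topology)
  show "continuous_map Z TM (\<lambda>z. inv_into E \<sigma> (\<sigma> (h z)))"
    by (rule continuous_map_eq[OF assms(1)]) (use funcset_mem[OF assms(2)] assms(3) in simp)
qed (use assms(2) in blast)

lemma semitopological_module_transport:
  assumes tsR: "topspace TR = carrier R"
    and M: "semitopological_module R TR M TM" and E: "submodule E R M" and inj: "inj_on \<sigma> E"
  shows "semitopological_module R TR (transport_module M E \<sigma>) (transport_topology TM E \<sigma>)"
    "linear_map R (transport_module M E \<sigma>) M (inv_into E \<sigma>)"
proof -
  interpret left_module R M using semitopological_moduleD[OF M] by simp
  let ?N = "transport_module M E \<sigma>" and ?T = "transport_topology TM E \<sigma>" and ?\<tau> = "inv_into E \<sigma>"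
  note EM = left_submoduleD[OF E]
  have E_carrier: "x \<in> carrier M" if "x \<in> E" for x using EM(1) that by blast
  have [simp]: "carrier ?N = \<sigma> ` E" "\<zero>\<^bsub>?N\<^esub> = \<sigma> \<zero>\<^bsub>M\<^esub>" by (simp_all add: transport_module_def)
  have \<tau>[simp]: "?\<tau> (\<sigma> x) = x" if "x \<in> E" for x using inj that by simp
  have add[simp]: "\<sigma> x \<oplus>\<^bsub>?N\<^esub> \<sigma> y = \<sigma> (x \<oplus>\<^bsub>M\<^esub> y)" if "x \<in> E" "y \<in> E" for x y
    using that by (simp add: transport_module_def)
  have smult[simp]: "a \<odot>\<^bsub>?N\<^esub> \<sigma> x = \<sigma> (a \<odot>\<^bsub>M\<^esub> x)" if "x \<in> E" for a x
    using that by (simp add: transport_module_def)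
  have grp: "abelian_group ?N"
  proof (rule abelian_groupI)
    fix u assume "u \<in> carrier ?N"
    then obtain x where x: "x \<in> E" "u = \<sigma> x" by auto
    show "\<exists>v\<in>carrier ?N. v \<oplus>\<^bsub>?N\<^esub> u = \<zero>\<^bsub>?N\<^esub>"
      by (rule bexI[of _ "\<sigma> (\<ominus>\<^bsub>M\<^esub> x)"]) (use x EM E_carrier M.l_neg in auto)
  qed (use EM E_carrier M.a_assoc M.a_comm in auto)
  interpret N: abelian_group ?N by (rule grp)
  have neg: "\<ominus>\<^bsub>?N\<^esub> \<sigma> x = \<sigma> (\<ominus>\<^bsub>M\<^esub> x)" if "x \<in> E" for x
    using that EM E_carrier M.l_neg by (intro N.minus_equality) auto
  have lm: "left_module R ?N"
  proof (intro left_module.intro left_module_axioms.intro grp R.ring_axioms)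
  qed (use EM E_carrier smult_l_distr smult_r_distr smult_assoc1 smult_one R.a_closed R.m_closed in auto)
  note tsM = semitopological_moduleD(4)[OF M]
  have tsT: "topspace ?T = \<sigma> ` E"
    using EM(1) tsM inj by (auto simp: transport_topology_def topspace_pullback_topology)
  note cont\<tau> = continuous_map_transport_topology_inverse[of TM E \<sigma>]
  note G = semitopological_moduleD(2)[OF M]
  have "continuous_map (prod_topology ?T ?T) TM (\<lambda>p. ?\<tau> (fst p) \<oplus>\<^bsub>M\<^esub> ?\<tau> (snd p))"
    using continuous_map_compose[OF continuous_map_fst cont\<tau>] continuous_map_compose[OF continuous_map_snd cont\<tau>]
    by (intro continuous_map_group_add[OF G]) (auto simp: o_def)
  then have "continuous_map (prod_topology ?T ?T) ?T (\<lambda>p. \<sigma> (?\<tau> (fst p) \<oplus>\<^bsub>M\<^esub> ?\<tau> (snd p)))"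
    by (rule continuous_map_into_transport_topology_o) (use tsT EM inj in auto)
  then have cont_add: "continuous_map (prod_topology ?T ?T) ?T (\<lambda>(u, v). u \<oplus>\<^bsub>?N\<^esub> v)"
    by (rule continuous_map_eq) (use tsT in auto)
  have "continuous_map ?T TM (\<lambda>u. \<ominus>\<^bsub>M\<^esub> ?\<tau> u)"
    using continuous_map_compose[OF cont\<tau>, of TM "\<lambda>x. \<ominus>\<^bsub>M\<^esub> x"] G
    by (simp add: topological_abelian_group_def o_def)
  then have "continuous_map ?T ?T (\<lambda>u. \<sigma> (\<ominus>\<^bsub>M\<^esub> ?\<tau> u))"
    by (rule continuous_map_into_transport_topology_o) (use tsT EM inj in auto)
  then have cont_neg: "continuous_map ?T ?T (\<lambda>u. \<ominus>\<^bsub>?N\<^esub> u)"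
    by (rule continuous_map_eq) (use tsT neg in auto)
  have haus: "Hausdorff_space ?T"
    by (rule Hausdorff_space_injective_preimage[OF semitopological_moduleD(3)[OF M] cont\<tau>])
      (use tsT in \<open>auto intro: inj_on_inv_into\<close>)
  have cont_r: "continuous_map ?T ?T (\<lambda>u. a \<odot>\<^bsub>?N\<^esub> u)" if a: "a \<in> carrier R" for a
  proof -
    have "continuous_map ?T TM (\<lambda>u. a \<odot>\<^bsub>M\<^esub> ?\<tau> u)"
      using continuous_map_compose[OF cont\<tau> semitopological_moduleD(5)[OF M a]] by (simp add: o_def)
    then have "continuous_map ?T ?T (\<lambda>u. \<sigma> (a \<odot>\<^bsub>M\<^esub> ?\<tau> u))"
      by (rule continuous_map_into_transport_topology_o) (use tsT EM inj a in auto)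
    then show ?thesis
      by (rule continuous_map_eq) (use tsT in auto)
  qed
  have cont_l: "continuous_map TR ?T (\<lambda>a. a \<odot>\<^bsub>?N\<^esub> u)"
    if u: "u \<in> carrier ?N" for u
  proof -
    obtain x where x: "x \<in> E" "u = \<sigma> x" using u by auto
    have "continuous_map TR ?T (\<lambda>a. \<sigma> (a \<odot>\<^bsub>M\<^esub> x))"
      by (rule continuous_map_into_transport_topology_o)
        (use x tsR EM inj semitopological_moduleD(6)[OF M E_carrier[OF x(1)]] in auto)
    then show ?thesis using x by simp
  qed
  show "semitopological_module R TR ?N ?T"
    unfolding semitopological_module_def topological_abelian_group_def
    using lm grp tsT cont_add cont_neg haus cont_r cont_l by simp
  show "linear_map R ?N M ?\<tau>"
    unfolding linear_map_def using EM E_carrier by auto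
qed

lemma linear_mapD:
  assumes "linear_map R M N g"
  shows "\<And>x. x \<in> carrier M \<Longrightarrow> g x \<in> carrier N"
    "\<And>x y. \<lbrakk>x \<in> carrier M; y \<in> carrier M\<rbrakk> \<Longrightarrow> g (x \<oplus>\<^bsub>M\<^esub> y) = g x \<oplus>\<^bsub>N\<^esub> g y"
    "\<And>a x. \<lbrakk>a \<in> carrier R; x \<in> carrier M\<rbrakk> \<Longrightarrow> g (a \<odot>\<^bsub>M\<^esub> x) = a \<odot>\<^bsub>N\<^esub> g x"
  using assms by (auto simp: linear_map_def)

lemma linear_map_o:
  assumes "linear_map R M N g" "linear_map R N P h"
  shows "linear_map R M P (\<lambda>x. h (g x))"
  using assms unfolding linear_map_def by (auto simp: Pi_iff)

lemma linear_map_cong: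
  assumes "linear_map R M N g" "left_module R M" "\<And>x. x \<in> carrier M \<Longrightarrow> h x = g x"
  shows "linear_map R M N h"
proof -
  interpret left_module R M by fact
  show ?thesis using assms(1,3) smult_closed unfolding linear_map_def by (auto simp: Pi_iff)
qed

lemma linear_map_into_transport:
  assumes "linear_map R M N g" "g \<in> carrier M \<rightarrow> E" "inj_on \<sigma> E"
  shows "linear_map R M (transport_module N E \<sigma>) (\<lambda>x. \<sigma> (g x))"
  using assms unfolding linear_map_def transport_module_def by (auto simp: Pi_iff)

lemma free_semitopological_moduleD:
  assumes "free_semitopological_module TYPE('u) R TR X M TM i"
  shows "semitopological_module R TR M TM" "continuous_map X TM i"
  using assms by (auto simp: free_semitopological_module_def)

text \<open>
  The target \<open>Y\<close> may have any carrier type, as long as some submodule of \<open>Y\<close> that contains the image of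
  \<open>f\<close> fits into the type for which freeness is known.
\<close>

lemma free_semitopological_module_extension:
  fixes \<sigma> :: "'y \<Rightarrow> 'u"
  assumes tsR: "topspace TR = carrier R"
    and free: "free_semitopological_module TYPE('u) R TR X M TM i"
    and Y: "semitopological_module R TR Y TY" and E: "submodule E R Y" and inj: "inj_on \<sigma> E"
    and f: "continuous_map X TY f" "f \<in> topspace X \<rightarrow> E"
  shows "\<exists>g. linear_map R M Y g \<and> continuous_map TM TY g \<and> g \<in> carrier M \<rightarrow> E \<and>
           (\<forall>x\<in>topspace X. g (i x) = f x)"
proof -
  let ?N = "transport_module Y E \<sigma>" and ?T = "transport_topology TY E \<sigma>" and ?\<tau> = "inv_into E \<sigma>"
  note N = semitopological_module_transport[OF tsR Y E inj]
  have "continuous_map X ?T (\<lambda>x. \<sigma> (f x))"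
    using f inj by (rule continuous_map_into_transport_topology_o)
  then have "extends_uniquely R X M TM i ?N ?T (\<lambda>x. \<sigma> (f x))"
    using free N(1) unfolding free_semitopological_module_def by blast
  then obtain g where g: "linear_map R M ?N g" "continuous_map TM ?T g"
      "\<forall>x\<in>topspace X. \<sigma> (f x) = g (i x)"
    unfolding extends_uniquely_def by blast
  have "linear_map R M Y (\<lambda>x. ?\<tau> (g x))"
    using g(1) N(2) by (rule linear_map_o)
  moreover have "continuous_map TM TY (\<lambda>x. ?\<tau> (g x))"
    using continuous_map_compose[OF g(2) continuous_map_transport_topology_inverse] by (simp add: o_def)
  moreover have "(\<lambda>x. ?\<tau> (g x)) \<in> carrier M \<rightarrow> E"
    using linear_mapD(1)[OF g(1)] by (auto simp: transport_module_def intro: inv_into_into)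
  moreover have "\<forall>x\<in>topspace X. ?\<tau> (g (i x)) = f x"
  proof
    fix x assume x: "x \<in> topspace X"
    have "?\<tau> (g (i x)) = ?\<tau> (\<sigma> (f x))" using g(3) x by simp
    also have "\<dots> = f x" using funcset_mem[OF f(2) x] inj by simp
    finally show "?\<tau> (g (i x)) = f x" .
  qed
  ultimately show ?thesis by blast
qed

text \<open>
  Apply uniqueness of extensions to a copy of \<open>M\<close> itself.
\<close>

lemma free_semitopological_module_endomorphism:
  fixes \<sigma> :: "'m \<Rightarrow> 'u" and M :: "('r, 'm, 'c) module_scheme"
  assumes tsR: "topspace TR = carrier R"
    and free: "free_semitopological_module TYPE('u) R TR X M TM i" and inj: "inj \<sigma>"
    and g: "linear_map R M M g" "continuous_map TM TM g" "\<forall>x\<in>topspace X. g (i x) = i x"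
    and m: "m \<in> carrier M"
  shows "g m = m"
proof -
  note M = free_semitopological_moduleD[OF free]
  interpret left_module R M using semitopological_moduleD[OF M(1)] by simp
  note tsM = semitopological_moduleD(4)[OF M(1)]
  let ?E = "carrier M"
  have inj': "inj_on \<sigma> ?E" using inj by (rule inj_on_subset) simp
  let ?N = "transport_module M ?E \<sigma>" and ?T = "transport_topology TM ?E \<sigma>"
  note N = semitopological_module_transport[OF tsR M(1) submodule_carrier inj']
  have i: "i \<in> topspace X \<rightarrow> ?E" using continuous_map_funspace[OF M(2)] tsM by simp
  have "continuous_map X ?T (\<lambda>x. \<sigma> (i x))"
    using M(2) i inj' by (rule continuous_map_into_transport_topology_o)
  then have ext: "extends_uniquely R X M TM i ?N ?T (\<lambda>x. \<sigma> (i x))"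
    using free N(1) unfolding free_semitopological_module_def by blast
  define extends where "extends h \<longleftrightarrow> h \<in> extensional ?E \<and> linear_map R M ?N h \<and>
      continuous_map TM ?T h \<and> (\<forall>x\<in>topspace X. \<sigma> (i x) = h (i x))" for h
  have unique: "\<exists>!h. extends h"
    using ext unfolding extends_uniquely_def extends_def .
  have *: "extends (restrict (\<lambda>x. \<sigma> (h x)) ?E)"
    if h: "linear_map R M M h" "continuous_map TM TM h" "\<forall>x\<in>topspace X. h (i x) = i x" for h
    unfolding extends_def
  proof (intro conjI ballI)
    have hM: "h \<in> carrier M \<rightarrow> carrier M" using linear_mapD(1)[OF h(1)] by auto
    show "linear_map R M ?N (restrict (\<lambda>x. \<sigma> (h x)) ?E)"
      using linear_map_into_transport[OF h(1) hM inj'] left_module_axioms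
      by (rule linear_map_cong) simp
    have "continuous_map TM ?T (\<lambda>x. \<sigma> (h x))"
      by (rule continuous_map_into_transport_topology_o) (use h hM inj' tsM in auto)
    then show "continuous_map TM ?T (restrict (\<lambda>x. \<sigma> (h x)) ?E)"
      by (rule continuous_map_eq) (simp add: tsM)
    show "\<sigma> (i x) = restrict (\<lambda>x. \<sigma> (h x)) ?E (i x)" if "x \<in> topspace X" for x
      using bspec[OF h(3) that] funcset_mem[OF i that] by simp
  qed simp
  have id: "linear_map R M M (\<lambda>x. x)" by (simp add: linear_map_def)
  have id_cont: "continuous_map TM TM (\<lambda>x. x)" using continuous_map_id[of TM] by (simp add: id_def)
  have "restrict (\<lambda>x. \<sigma> (g x)) ?E = restrict \<sigma> ?E"
    using unique *[OF g] *[OF id id_cont] by auto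
  then have "\<sigma> (g m) = \<sigma> m" using m by (metis restrict_apply')
  then show ?thesis using inj by (simp add: inj_eq)
qed

text \<open>
  The equalizer \<open>E\<close> of \<open>g\<close> and \<open>h\<close> is a submodule that contains the image of \<open>i\<close>. Extending \<open>i\<close> to a map
  \<open>M \<rightarrow> E\<close> gives an endomorphism of \<open>M\<close> that fixes the generators, hence is the identity; so \<open>E = M\<close>.
\<close>

lemma free_semitopological_module_extension_unique:
  fixes \<sigma> :: "'m \<Rightarrow> 'u" and M :: "('r, 'm, 'c) module_scheme"
  assumes tsR: "topspace TR = carrier R"
    and free: "free_semitopological_module TYPE('u) R TR X M TM i" and inj: "inj \<sigma>"
    and Y: "left_module R Y"
    and g: "linear_map R M Y g" and h: "linear_map R M Y h"
    and eq: "\<And>x. x \<in> topspace X \<Longrightarrow> g (i x) = h (i x)"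
    and m: "m \<in> carrier M"
  shows "g m = h m"
proof -
  note M = free_semitopological_moduleD[OF free]
  interpret left_module R M using semitopological_moduleD[OF M(1)] by simp
  interpret Y: left_module R Y by fact
  have null: "k \<zero>\<^bsub>M\<^esub> = \<zero>\<^bsub>Y\<^esub>" if "linear_map R M Y k" for k
    using linear_mapD(3)[OF that, of "\<zero>\<^bsub>R\<^esub>" "\<zero>\<^bsub>M\<^esub>"] linear_mapD(1)[OF that, of "\<zero>\<^bsub>M\<^esub>"]
    by (simp add: smult_l_null Y.smult_l_null)
  define E where "E = {m \<in> carrier M. g m = h m}"
  have E: "submodule E R M"
  proof (rule left_submoduleI)
    have "\<zero>\<^bsub>M\<^esub> \<in> E" using null[OF g] null[OF h] by (simp add: E_def)
    then show "E \<noteq> {}" by blast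
  qed (auto simp: E_def smult_closed linear_mapD(2,3)[OF g] linear_mapD(2,3)[OF h])
  have "i \<in> topspace X \<rightarrow> E"
    using continuous_map_funspace[OF M(2)] semitopological_moduleD(4)[OF M(1)] eq by (auto simp: E_def)
  then obtain k where k: "linear_map R M M k" "continuous_map TM TM k" "k \<in> carrier M \<rightarrow> E"
      "\<forall>x\<in>topspace X. k (i x) = i x"
    using free_semitopological_module_extension[OF tsR free M(1) E inj_on_subset[OF inj subset_UNIV] M(2)]
    by blast
  have "k m = m"
    using free_semitopological_module_endomorphism[OF tsR free inj k(1,2,4) m] .
  then show ?thesis using k(3) m by (auto simp: E_def Pi_iff)
qed

text \<open>
  Freeness relative to the type \<open>'m + ('x \<Rightarrow> 'r)\<close> implies freeness relative to every type: the left summand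
  hosts the copies of submodules of \<open>M\<close> used for uniqueness, the right one a copy of the span of the
  image of \<open>f\<close>, each element of which is represented by a coefficient function.
\<close>

lemma free_semitopological_module_extends_uniquely:
  fixes M :: "('r, 'm, 'c) module_scheme" and X :: "'x topology"
  assumes tsR: "topspace TR = carrier R"
    and free: "free_semitopological_module TYPE('m + ('x \<Rightarrow> 'r)) R TR X M TM i"
    and Y: "semitopological_module R TR Y TY" and f: "continuous_map X TY f"
  shows "extends_uniquely R X M TM i Y TY f"
proof -
  note M = free_semitopological_moduleD[OF free]
  interpret left_module R M using semitopological_moduleD[OF M(1)] by simp
  interpret Y: left_module R Y using semitopological_moduleD[OF Y] by simp
  note tsM = semitopological_moduleD(4)[OF M(1)] and tsY = semitopological_moduleD(4)[OF Y]
  have iM: "i x \<in> carrier M" if "x \<in> topspace X" for x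
    using continuous_map_funspace[OF M(2)] tsM that by auto
  have fY: "f \<in> topspace X \<rightarrow> carrier Y" using continuous_map_funspace[OF f] tsY by simp
  let ?F = "finitely_supported_functions R (topspace X)"
  let ?c = "linear_combination R Y f"
  define \<sigma> :: "_ \<Rightarrow> 'm + ('x \<Rightarrow> 'r)" where "\<sigma> = Inr \<circ> inv_into ?F ?c"
  have "inj_on \<sigma> (?c ` ?F)"
    unfolding \<sigma>_def by (intro comp_inj_on inj_on_inv_into) auto
  moreover have "f \<in> topspace X \<rightarrow> ?c ` ?F"
    using Y.submodule_linear_combinations(2)[OF fY] by blast
  ultimately obtain g where g: "linear_map R M Y g" "continuous_map TM TY g" "\<forall>x\<in>topspace X. g (i x) = f x"
    using free_semitopological_module_extension[OF tsR free Y Y.submodule_linear_combinations(1)[OF fY] _ f]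
    by blast
  show ?thesis
    unfolding extends_uniquely_def
  proof (rule ex1I[of _ "restrict g (carrier M)"], intro conjI ballI)
    show "linear_map R M Y (restrict g (carrier M))"
      using g(1) left_module_axioms by (rule linear_map_cong) simp
    show "continuous_map TM TY (restrict g (carrier M))"
      using g(2) by (rule continuous_map_eq) (simp add: tsM)
    show "f x = restrict g (carrier M) (i x)" if "x \<in> topspace X" for x
      using g(3) iM that by simp
  next
    fix h assume h: "h \<in> extensional (carrier M) \<and> linear_map R M Y h \<and> continuous_map TM TY h \<and>
      (\<forall>x\<in>topspace X. f x = h (i x))"
    show "h = restrict g (carrier M)"
    proof (rule extensionalityI[of _ "carrier M"])
      fix m assume m: "m \<in> carrier M"
      have "h m = g m"
        by (rule free_semitopological_module_extension_unique[OF tsR free inj_Inl Y.left_module_axioms _ g(1) _ m])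
          (use h g(3) in auto)
      then show "h m = restrict g (carrier M) m" using m by simp
    qed (use h in auto)
  qed simp
qed

section \<open>Free semitopological modules are free topological modules\<close>

theorem theorem6p1:
  fixes R :: "'r ring" and TR :: "'r topology"
    and X :: "'x topology"
    and M :: "('r, 'm) module" and TM :: "'m topology" and i :: "'x \<Rightarrow> 'm"
  assumes "topological_ring R TR"
    and "locally_compact_space TR"
    and "tychonoff_space X"
    and "k_space X"
    and "free_semitopological_module TYPE('m + ('x \<Rightarrow> 'r)) R TR X M TM i"
  shows "free_topological_module TYPE('v) R TR X M TM i"
proof -
  note R = assms(1,2) and free = assms(5)
  have tsR: "topspace TR = carrier R" using topological_ringD[OF R(1)] by simp
  note M = free_semitopological_moduleD[OF free]
  interpret left_module R M using semitopological_moduleD[OF M(1)] by simp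
  note tsM = semitopological_moduleD(4)[OF M(1)]
  let ?T = "compact_open_module_topology R TR M TM"
  note T = semitopological_module_compact_open[OF R M(1)]
  have iM: "i \<in> topspace X \<rightarrow> carrier M" using continuous_map_funspace[OF M(2)] tsM by simp
  \<comment> \<open>The universal property, applied to \<open>M\<close> with the compact-open topology, yields a continuous map that
      must be the identity.\<close>
  have "continuous_map X ?T i"
    using iM continuous_map_smult_k_space[OF R M(1) assms(4) M(2)]
    by (rule continuous_map_into_compact_open_module_topology)
  then obtain g where g: "linear_map R M M g" "continuous_map TM ?T g" "\<forall>x\<in>topspace X. g (i x) = i x"
    using free_semitopological_module_extension[OF tsR free T(2) submodule_carrier inj_Inl _ iM]
    by blast
  have "continuous_map TM TM g"
    using continuous_map_compose[OF g(2) T(1)] by (simp add: o_def)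
  then have "g m = m" if "m \<in> carrier M" for m
    using free_semitopological_module_endomorphism[OF tsR free inj_Inl g(1) _ g(3) that] by blast
  then have "continuous_map TM ?T (\<lambda>m. m)"
    using tsM by (intro continuous_map_eq[OF g(2)]) auto
  then have "continuous_map (prod_topology TR TM) (prod_topology TR ?T) (\<lambda>p. (fst p, snd p))"
    using continuous_map_compose[OF continuous_map_snd, of TM ?T "\<lambda>m. m" TR]
    by (intro continuous_map_pairedI continuous_map_fst) (simp add: o_def)
  then have "continuous_map (prod_topology TR TM) TM (\<lambda>(a, m). a \<odot>\<^bsub>M\<^esub> m)"
    using continuous_map_compose[OF _ continuous_map_smult_compact_open_module_topology[OF R M(1)]]
    by (fastforce simp: o_def split_beta')
  then have "topological_module R TR M TM"
    using semitopological_moduleD[OF M(1)] by (simp add: topological_module_def)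
  moreover have "extends_uniquely R X M TM i Y TY f"
    if "topological_module R TR Y TY" "continuous_map X TY f" for Y :: "('r, 'v) module" and TY f
    using free_semitopological_module_extends_uniquely[OF tsR free
        topological_module_imp_semitopological_module[OF tsR that(1)] that(2)] .
  ultimately show ?thesis
    using M(2) by (simp add: free_topological_module_def)
qed

end
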